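(* Let $k\in\{3,4,5\}$ and $\epsilon\in(0,1)$. Assume that the starting values preserve the volume, $\langle\phi^\ell,1\rangle=\langle\phi^0,1\rangle$ for $1\le\ell\le k-1$; that the time-step size satisfies $\tau\le\frac{2}{3\epsilon}\min\{b_0^{(k)},\sigma_{Lk}\}$; and that there is a constant $c_0$, independent of the time-step size $\tau$ (but possibly depending on the problem and the starting values), such that $\mathcal{E}_k[\vec\phi^{k-1}]\le c_0$. Then the solution of the BDF-$k$ scheme $$D_k\phi^n=\Delta\mu^n,\qquad \mu^n=(1+\Delta)^2\phi^n+(\phi^n)^3-\epsilon\phi^n,\qquad k\le n\le N,$$ with periodic boundary conditions on $\Omega$, is stable in the $L^\infty$ norm: $$\|\phi^n\|_{L^\infty}\le c_1:=c_\Omega\sqrt{8c_0+2(2+\epsilon)^2|\Omega|}\qquad\text{for } k\le n\le N,$$ where $c_1$ may depend on the problem and the starting values but is independent of the time-step size $\tau$ and the time $t_n$.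
   Context: Setting: $\Omega\subset\mathbb{R}^2$ is a bounded periodic cell with measure $|\Omega|$; all functions are real-valued and $\Omega$-periodic. $\langle f,g\rangle=\int_\Omega fg\,d\mathbf{x}$, $\|f\|=\sqrt{\langle f,f\rangle}$, $\|v\|_{L^\infty}=\max_{\mathbf{x}\in\Omega}|v|$. $c_\Omega$ is a constant, depending only on $\Omega$, for which the embedding inequality $\|v\|_{L^\infty}\le c_\Omega(\|v\|+\|\Delta v\|)$ holds for all periodic $v$. For mean-zero functions $v,w$, $\langle v,w\rangle_{-1}:=\langle(-\Delta)^{-1}v,w\rangle$ and $\|v\|_{-1}:=\sqrt{\langle v,v\rangle_{-1}}$. Only time is discretized: $t_n=n\tau$, $\tau=T/N$; $\phi^0,\phi^1,\dots,\phi^{k-1}$ are given. Notation: $\nabla_\tau v^n:=v^n-v^{n-1}$. $D_kv^n:=\frac1\tau\sum_{j=1}^nb_{n-j}^{(k)}\nabla_\tau v^j$ for $n\ge k$, where $\sum_{\ell=1}^{k}\frac1\ell(1-\zeta)^{\ell-1}=\sum_{\ell=0}^{k-1}b_\ell^{(k)}\zeta^\ell$ and $b_j^{(k)}:=0$ for $j\ge k$; in particular $b_0^{(3)}=\frac{11}6$, $b_0^{(4)}=\frac{25}{12}$, $b_0^{(5)}=\frac{137}{60}$. Constants: $\sigma_{L3}=\frac{95}{48}$, $\sigma_{L4}=\frac{4919}{3072}$, $\sigma_{L5}=\frac{646631}{1920000}$. Quadratic functionals (with $\delta_1v_n:=v_n-v_{n-1}$ and $\vec v_n:=(v_n,v_{n-1},\dots)$):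 $\mathcal{G}_3[\vec v_n]=\frac16v_n^2+\frac16(\frac74v_n-v_{n-1})^2$; $\mathcal{G}_4[\vec v_n]=\frac{13627}{43008}v_n^2+\frac7{24}(\frac{65}{56}v_n-v_{n-1})^2+\frac18(\frac32\delta_1v_n+v_{n-2})^2$; $\mathcal{G}_5[\vec v_n]=\frac{1198850903}{1678080000}v_n^2+\frac{437}{900}(\frac{4931}{6992}v_n-v_{n-1})^2+\frac9{40}(\frac{23}{18}\delta_1v_n+v_{n-2})^2+\frac1{10}(2\delta_1v_n+2v_{n-2}-v_{n-3})^2$. $\langle\mathcal{G}_k[\nabla_\tau\vec\phi^n],1\rangle_{-1}$ denotes the expression obtained from $\mathcal{G}_k[\vec v_n]$ by substituting $v_m=\nabla_\tau\phi^m$ and replacing each square $(\cdot)^2$ by $\|\cdot\|_{-1}^2$. Energies: $E[\phi^n]:=\frac12\|(1+\Delta)\phi^n\|^2+\frac14\|(\phi^n)^2-\epsilon\|^2-\frac14\|\epsilon\|^2$, and $\mathcal{E}_k[\vec\phi^n]:=E[\phi^n]+\frac1\tau\langle\mathcal{G}_k[\nabla_\tau\vec\phi^n],1\rangle_{-1}$ for $n\ge k-1$. *)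

theory Defs
  imports "HOL-Analysis.Analysis" "HOL-Computational_Algebra.Polynomial"
begin

subsection \<open>Periodic functions on the plane\<close>

text \<open>
  The columns of an invertible matrix \<open>P\<close> are the two periods; the cell is the
  half-open parallelogram spanned by them. A diagonal \<open>P\<close> gives a rectangle.
\<close>

definition cell :: "real^2^2 \<Rightarrow> (real^2) set" where
  "cell P = (\<lambda>s. P *v s) ` {s. \<forall>i. 0 \<le> s $ i \<and> s $ i < 1}"

definition periodic :: "real^2^2 \<Rightarrow> (real^2 \<Rightarrow> real) \<Rightarrow> bool" where
  "periodic P f \<longleftrightarrow> (\<forall>x i. f (x + column i P) = f x)"

definition partial :: "real^2 \<Rightarrow> (real^2 \<Rightarrow> real) \<Rightarrow> real^2 \<Rightarrow> real" where
  "partial e f x = frechet_derivative f (at x) e"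

primrec class_C :: "nat \<Rightarrow> (real^2 \<Rightarrow> real) \<Rightarrow> bool" where
  "class_C 0 f \<longleftrightarrow> continuous_on UNIV f"
| "class_C (Suc m) f \<longleftrightarrow>
     (\<forall>x. f differentiable (at x)) \<and> (\<forall>e\<in>Basis. class_C m (partial e f))"

definition C_per :: "nat \<Rightarrow> real^2^2 \<Rightarrow> (real^2 \<Rightarrow> real) set" where
  "C_per m P = {f. class_C m f \<and> periodic P f}"

definition laplacian :: "(real^2 \<Rightarrow> real) \<Rightarrow> real^2 \<Rightarrow> real" where
  "laplacian f x = (\<Sum>e\<in>Basis. partial e (partial e f) x)"

definition L2_inner :: "real^2^2 \<Rightarrow> (real^2 \<Rightarrow> real) \<Rightarrow> (real^2 \<Rightarrow> real) \<Rightarrow> real" where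
  "L2_inner P f g = (LINT x:cell P|lebesgue. f x * g x)"

definition L2_norm :: "real^2^2 \<Rightarrow> (real^2 \<Rightarrow> real) \<Rightarrow> real" where
  "L2_norm P f = sqrt (L2_inner P f f)"

text \<open>For continuous periodic functions this supremum is attained in the half-open cell.\<close>

definition Linf_norm :: "real^2^2 \<Rightarrow> (real^2 \<Rightarrow> real) \<Rightarrow> real" where
  "Linf_norm P v = (SUP x\<in>cell P. \<bar>v x\<bar>)"

text \<open>
  \<open>(-\<Delta>)\<^sup>-\<^sup>1 v\<close> is the unique mean-zero periodic solution \<open>u\<close> of \<open>-\<Delta> u = v\<close>; it is only
  meaningful for mean-zero \<open>v\<close>. Every mean-zero \<open>v \<in> C_per 2 P\<close> has such a solution.
\<close>

definition inv_neg_laplacian :: "real^2^2 \<Rightarrow> (real^2 \<Rightarrow> real) \<Rightarrow> real^2 \<Rightarrow> real" where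
  "inv_neg_laplacian P v =
     (THE u. u \<in> C_per 2 P \<and> L2_inner P u (\<lambda>_. 1) = 0 \<and> (\<forall>x. - laplacian u x = v x))"

definition Hm1_inner :: "real^2^2 \<Rightarrow> (real^2 \<Rightarrow> real) \<Rightarrow> (real^2 \<Rightarrow> real) \<Rightarrow> real" where
  "Hm1_inner P v w = L2_inner P (inv_neg_laplacian P v) w"

definition Hm1_norm :: "real^2^2 \<Rightarrow> (real^2 \<Rightarrow> real) \<Rightarrow> real" where
  "Hm1_norm P v = sqrt (Hm1_inner P v v)"


subsection \<open>The BDF formula\<close>

definition bdf_gen :: "nat \<Rightarrow> real poly" where
  "bdf_gen k = (\<Sum>l=1..k. smult (1 / real l) ([:1, -1:] ^ (l - 1)))"

definition bdf_coeff :: "nat \<Rightarrow> nat \<Rightarrow> real" where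
  "bdf_coeff k j = coeff (bdf_gen k) j"

lemma bdf_coeff_eq_0: "bdf_coeff k j = 0" if "1 \<le> k" "k \<le> j"
proof -
  have "coeff ([:1, -1:] ^ (l - 1) :: real poly) j = 0" if "l \<in> {1..k}" for l
  proof (rule coeff_eq_0)
    have "degree ([:1, -1:] ^ (l - 1) :: real poly) = l - 1"
      by (simp add: degree_power_eq)
    then show "degree ([:1, -1:] ^ (l - 1) :: real poly) < j"
      using that \<open>k \<le> j\<close> by (simp, linarith)
  qed
  then show ?thesis
    by (simp add: bdf_coeff_def bdf_gen_def coeff_sum)
qed

lemma bdf_coeff_values:
  "bdf_coeff 3 0 = 11/6" "bdf_coeff 4 0 = 25/12" "bdf_coeff 5 0 = 137/60"
  by (simp_all add: bdf_coeff_def bdf_gen_def coeff_sum coeff_0_power eval_nat_numeral)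

definition backward_diff :: "(nat \<Rightarrow> 'x \<Rightarrow> real) \<Rightarrow> nat \<Rightarrow> 'x \<Rightarrow> real" where
  "backward_diff v n = (\<lambda>x. v n x - v (n - 1) x)"

definition bdf :: "nat \<Rightarrow> real \<Rightarrow> (nat \<Rightarrow> 'x \<Rightarrow> real) \<Rightarrow> nat \<Rightarrow> 'x \<Rightarrow> real" where
  "bdf k \<tau> v n = (\<lambda>x. 1 / \<tau> * (\<Sum>j=1..n. bdf_coeff k (n - j) * backward_diff v j x))"

definition sigma_L :: "nat \<Rightarrow> real" where
  "sigma_L k = (if k = 3 then 95/48 else if k = 4 then 4919/3072 else 646631/1920000)"


subsection \<open>Quadratic functionals and energies\<close>

text \<open>
  The functionals \<open>\<G>\<^sub>k\<close>, with the squaring operation \<open>sq\<close> as a parameter: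
  \<open>sq f = (f x)\<^sup>2\<close> is the pointwise functional, and \<open>sq f = (Hm1_norm P f)\<^sup>2\<close> yields
  \<open>\<langle>\<G>\<^sub>k[\<cdot>], 1\<rangle>\<close> in the negative-order inner product.
\<close>

definition G3 :: "(('x \<Rightarrow> real) \<Rightarrow> real) \<Rightarrow> (nat \<Rightarrow> 'x \<Rightarrow> real) \<Rightarrow> nat \<Rightarrow> real" where
  "G3 sq v n = 1/6 * sq (v n) + 1/6 * sq (\<lambda>x. 7/4 * v n x - v (n - 1) x)"

definition G4 :: "(('x \<Rightarrow> real) \<Rightarrow> real) \<Rightarrow> (nat \<Rightarrow> 'x \<Rightarrow> real) \<Rightarrow> nat \<Rightarrow> real" where
  "G4 sq v n = 13627/43008 * sq (v n)
     + 7/24 * sq (\<lambda>x. 65/56 * v n x - v (n - 1) x)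
     + 1/8 * sq (\<lambda>x. 3/2 * backward_diff v n x + v (n - 2) x)"

definition G5 :: "(('x \<Rightarrow> real) \<Rightarrow> real) \<Rightarrow> (nat \<Rightarrow> 'x \<Rightarrow> real) \<Rightarrow> nat \<Rightarrow> real" where
  "G5 sq v n = 1198850903/1678080000 * sq (v n)
     + 437/900 * sq (\<lambda>x. 4931/6992 * v n x - v (n - 1) x)
     + 9/40 * sq (\<lambda>x. 23/18 * backward_diff v n x + v (n - 2) x)
     + 1/10 * sq (\<lambda>x. 2 * backward_diff v n x + 2 * v (n - 2) x - v (n - 3) x)"

definition G :: "nat \<Rightarrow> (('x \<Rightarrow> real) \<Rightarrow> real) \<Rightarrow> (nat \<Rightarrow> 'x \<Rightarrow> real) \<Rightarrow> nat \<Rightarrow> real" where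
  "G k = (if k = 3 then G3 else if k = 4 then G4 else G5)"

definition one_plus_laplacian :: "(real^2 \<Rightarrow> real) \<Rightarrow> real^2 \<Rightarrow> real" where
  "one_plus_laplacian f = (\<lambda>x. f x + laplacian f x)"

definition energy :: "real^2^2 \<Rightarrow> real \<Rightarrow> (real^2 \<Rightarrow> real) \<Rightarrow> real" where
  "energy P \<epsilon> f = 1/2 * (L2_norm P (one_plus_laplacian f))\<^sup>2
     + 1/4 * (L2_norm P (\<lambda>x. (f x)\<^sup>2 - \<epsilon>))\<^sup>2 - 1/4 * (L2_norm P (\<lambda>_. \<epsilon>))\<^sup>2"

definition mod_energy ::
  "real^2^2 \<Rightarrow> real \<Rightarrow> nat \<Rightarrow> real \<Rightarrow> (nat \<Rightarrow> real^2 \<Rightarrow> real) \<Rightarrow> nat \<Rightarrow> real" where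
  "mod_energy P \<epsilon> k \<tau> \<phi> n =
     energy P \<epsilon> (\<phi> n) + 1 / \<tau> * G k (\<lambda>f. (Hm1_norm P f)\<^sup>2) (backward_diff \<phi>) n"

definition chem_potential :: "real \<Rightarrow> (real^2 \<Rightarrow> real) \<Rightarrow> real^2 \<Rightarrow> real" where
  "chem_potential \<epsilon> f =
     (\<lambda>x. one_plus_laplacian (one_plus_laplacian f) x + (f x)^3 - \<epsilon> * f x)"

end

theory Submission
  imports Defs
begin

text \<open>
  The bound follows from the decay of the modified energy. Testing the scheme with
  \<open>(-\<Delta>)\<^sup>-\<^sup>1 v\<close> for the increment \<open>v = \<phi>\<^sup>n - \<phi>\<^sup>n\<^sup>-\<^sup>1\<close> yields two kinds of terms. The BDF formula
  contributes the difference of the functional \<open>\<G>\<^sub>k\<close> between two steps, the term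
  \<open>\<sigma>/2 \<parallel>v\<parallel>\<^sub>-\<^sub>1\<^sup>2\<close> and a sum of squares (\<open>bdf_gradient_structure\<close>). The chemical potential
  contributes the energy difference and \<open>1/2 \<parallel>(1 + \<Delta>) v\<parallel>\<^sup>2\<close>, up to the defect \<open>\<epsilon>/2 \<parallel>v\<parallel>\<^sup>2\<close> of the
  nonconvex potential (\<open>energy_difference\<close>). The inequality
  \<open>\<parallel>v\<parallel>\<^sup>2 \<le> \<parallel>(1 + \<Delta>) v\<parallel>\<^sup>2 + 3/2 \<parallel>v\<parallel>\<^sub>-\<^sub>1\<^sup>2\<close> (\<open>Hm1_interpolation\<close>) absorbs this defect if
  \<open>\<tau> \<le> 2\<sigma>/(3\<epsilon>)\<close>. So the modified energy does not increase (\<open>mod_energy_decreasing_step\<close>). As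
  \<open>\<G>\<^sub>k\<close> is nonnegative, the energy stays below \<open>c\<^sub>0\<close>; it controls \<open>\<parallel>\<phi>\<parallel> + \<parallel>\<Delta>\<phi>\<parallel>\<close> (\<open>H2_bound\<close>), and the
  embedding inequality concludes.

  The analytic groundwork is twofold. Green's formulas on the cell rest on the translation
  invariance of the integral of a periodic function (\<open>cell_integral_translate_column\<close>), by which
  derivatives integrate to zero. The inverse Laplacian is a definite description, so its use
  requires that the periodic Poisson problem be uniquely solvable in \<open>C\<^sup>2\<close>. Uniqueness is
  a consequence of Green's formula. Existence (\<open>poisson_solvable\<close>) is proved by expansion into plane
  waves, whose completeness comes from the Stone--Weierstrass theorem on the torus
  (\<open>wave_complete\<close>).
\<close>

section \<open>Calculus of smooth periodic functions\<close>

lemma partial_eqI: "(f has_derivative f') (at x) \<Longrightarrow> partial e f x = f' e"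
  unfolding partial_def using frechet_derivative_at by metis

lemma has_derivative_partial:
  assumes "f differentiable (at x)"
  shows "(f has_derivative (\<lambda>h. \<Sum>e\<in>Basis. (h \<bullet> e) * partial e f x)) (at x)"
proof -
  have D: "(f has_derivative frechet_derivative f (at x)) (at x)"
    using assms frechet_derivative_works by blast
  then interpret bounded_linear "frechet_derivative f (at x)" by (rule has_derivative_bounded_linear)
  have "frechet_derivative f (at x) = (\<lambda>h. \<Sum>e\<in>Basis. (h \<bullet> e) * partial e f x)"
  proof
    fix h :: "real^2"
    have "frechet_derivative f (at x) h = frechet_derivative f (at x) (\<Sum>e\<in>Basis. (h \<bullet> e) *\<^sub>R e)"
      by (simp add: euclidean_representation)
    also have "\<dots> = (\<Sum>e\<in>Basis. (h \<bullet> e) * partial e f x)"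
      by (simp add: sum scaleR partial_def)
    finally show "frechet_derivative f (at x) h = (\<Sum>e\<in>Basis. (h \<bullet> e) * partial e f x)" .
  qed
  with D show ?thesis by metis
qed

lemma class_C_imp_continuous: "class_C m f \<Longrightarrow> continuous_on UNIV f"
  by (cases m) (auto intro!: continuous_at_imp_continuous_on differentiable_imp_continuous_within)

lemma class_C_SucD: "class_C (Suc m) f \<Longrightarrow> class_C m f"
proof (induction m arbitrary: f)
  case 0
  then show ?case by (metis class_C.simps(1) class_C_imp_continuous)
next
  case (Suc m)
  have "\<forall>e\<in>Basis. class_C (Suc m) (partial e f)" "\<forall>x. f differentiable (at x)"
    using Suc.prems class_C.simps(2) by blast+
  then show ?case using Suc.IH class_C.simps(2) by blast
qed

lemma class_C_mono: "class_C n f \<Longrightarrow> m \<le> n \<Longrightarrow> class_C m f"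
  by (induction n) (metis le_zero_eq, metis class_C_SucD le_Suc_eq)

lemma partial_const [simp]: "partial e (\<lambda>_. c) = (\<lambda>_. 0)"
  by (rule ext, rule partial_eqI[THEN trans]) auto

lemma class_C_const [simp]: "class_C m (\<lambda>_. c)"
  by (induction m arbitrary: c) auto

lemma partial_add:
  assumes "f differentiable (at x)" "g differentiable (at x)"
  shows "partial e (\<lambda>x. f x + g x) x = partial e f x + partial e g x"
  using has_derivative_add[OF assms[unfolded frechet_derivative_works]]
  by (rule partial_eqI[THEN trans]) (simp add: partial_def)

lemma partial_mult:
  assumes "f differentiable (at x)" "g differentiable (at x)"
  shows "partial e (\<lambda>x. f x * g x) x = f x * partial e g x + partial e f x * g x"
  using has_derivative_mult[OF assms[unfolded frechet_derivative_works]]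
  by (rule partial_eqI[THEN trans]) (simp add: partial_def)

lemma class_C_add: "class_C m f \<Longrightarrow> class_C m g \<Longrightarrow> class_C m (\<lambda>x. f x + g x)"
proof (induction m arbitrary: f g)
  case 0
  then show ?case by (simp add: continuous_intros)
next
  case (Suc m)
  have "partial e (\<lambda>x. f x + g x) = (\<lambda>x. partial e f x + partial e g x)" for e
    using Suc.prems by (auto simp: partial_add)
  then show ?case using Suc by auto
qed

lemma class_C_mult: "class_C m f \<Longrightarrow> class_C m g \<Longrightarrow> class_C m (\<lambda>x. f x * g x)"
proof (induction m arbitrary: f g)
  case 0
  then show ?case by (simp add: continuous_intros)
next
  case (Suc m)
  have "partial e (\<lambda>x. f x * g x) = (\<lambda>x. f x * partial e g x + partial e f x * g x)" for e
    using Suc.prems by (auto simp: partial_mult)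
  moreover have "class_C m f" "class_C m g"
    using Suc.prems class_C_SucD by blast+
  ultimately show ?case using Suc by (auto intro!: class_C_add)
qed

lemma class_C_cmult: "class_C m f \<Longrightarrow> class_C m (\<lambda>x. c * f x)"
  by (rule class_C_mult) auto

lemma class_C_diff: "class_C m f \<Longrightarrow> class_C m g \<Longrightarrow> class_C m (\<lambda>x. f x - g x)"
  using class_C_add[of m f "\<lambda>x. (-1) * g x"] class_C_cmult[of m g "-1"] by simp

lemma class_C_power: "class_C m f \<Longrightarrow> class_C m (\<lambda>x. f x ^ n)"
  by (induction n) (auto intro: class_C_mult)

lemma class_C_sum: "(\<And>i. i \<in> A \<Longrightarrow> class_C m (f i)) \<Longrightarrow> class_C m (\<lambda>x. \<Sum>i\<in>A. f i x)"
  by (induction A rule: infinite_finite_induct) (auto intro: class_C_add)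

lemma periodic_partial:
  assumes "periodic P f" shows "periodic P (partial e f)"
  unfolding periodic_def
proof (intro allI)
  fix x i
  let ?c = "column i P"
  have f: "(\<lambda>y. f (y + ?c)) = f" using assms by (auto simp: periodic_def)
  have 1: "(f has_derivative D) (at (x + ?c)) \<longleftrightarrow> (f has_derivative D) (at x)" for D
  proof
    assume *: "(f has_derivative D) (at (x + ?c))"
    have "((\<lambda>y. y + ?c) has_derivative (\<lambda>h. h)) (at x)"
      by (auto intro!: derivative_eq_intros)
    from has_derivative_compose[OF this *] have "((\<lambda>y. f (y + ?c)) has_derivative D) (at x)"
      by simp
    then show "(f has_derivative D) (at x)" by (simp add: f)
  next
    assume "(f has_derivative D) (at x)"
    then have *: "(f has_derivative D) (at (x + ?c - ?c))" by simp
    have "((\<lambda>y. y - ?c) has_derivative (\<lambda>h. h)) (at (x + ?c))"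
      by (auto intro!: derivative_eq_intros)
    from has_derivative_compose[OF this *]
    have "((\<lambda>y. f (y - ?c)) has_derivative D) (at (x + ?c))" by simp
    moreover have "(\<lambda>y. f (y - ?c)) = f"
      using fun_cong[OF f, of "_ - ?c"] by auto
    ultimately show "(f has_derivative D) (at (x + ?c))" by simp
  qed
  show "partial e f (x + ?c) = partial e f x"
    by (simp add: partial_def frechet_derivative_def 1)
qed

lemma C_per_mono: "f \<in> C_per n P \<Longrightarrow> m \<le> n \<Longrightarrow> f \<in> C_per m P"
  using class_C_mono by (auto simp: C_per_def)

lemma C_per_continuous: "f \<in> C_per m P \<Longrightarrow> continuous_on UNIV f"
  using class_C_imp_continuous by (auto simp: C_per_def)

lemma C_per_imp_0: "f \<in> C_per m P \<Longrightarrow> f \<in> C_per 0 P"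
  by (erule C_per_mono) simp

lemma C_per_differentiable: "f \<in> C_per m P \<Longrightarrow> 0 < m \<Longrightarrow> f differentiable (at x)"
  by (cases m) (auto simp: C_per_def)

lemma C_per_partial: "f \<in> C_per (Suc m) P \<Longrightarrow> e \<in> Basis \<Longrightarrow> partial e f \<in> C_per m P"
  by (auto simp: C_per_def periodic_partial)

lemma C_per_const: "(\<lambda>_. c) \<in> C_per m P"
  by (simp add: C_per_def periodic_def)

lemma C_per_add: "f \<in> C_per m P \<Longrightarrow> g \<in> C_per m P \<Longrightarrow> (\<lambda>x. f x + g x) \<in> C_per m P"
  by (auto simp: C_per_def periodic_def class_C_add)

lemma C_per_diff: "f \<in> C_per m P \<Longrightarrow> g \<in> C_per m P \<Longrightarrow> (\<lambda>x. f x - g x) \<in> C_per m P"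
  by (auto simp: C_per_def periodic_def class_C_diff)

lemma C_per_mult: "f \<in> C_per m P \<Longrightarrow> g \<in> C_per m P \<Longrightarrow> (\<lambda>x. f x * g x) \<in> C_per m P"
  by (auto simp: C_per_def periodic_def class_C_mult)

lemma C_per_power: "f \<in> C_per m P \<Longrightarrow> (\<lambda>x. f x ^ n) \<in> C_per m P"
  by (auto simp: C_per_def periodic_def class_C_power)

lemma C_per_cmult: "f \<in> C_per m P \<Longrightarrow> (\<lambda>x. c * f x) \<in> C_per m P"
  by (auto simp: C_per_def periodic_def class_C_cmult)

lemma C_per_sum: "(\<And>i. i \<in> A \<Longrightarrow> f i \<in> C_per m P) \<Longrightarrow> (\<lambda>x. \<Sum>i\<in>A. f i x) \<in> C_per m P"
  by (auto simp: C_per_def periodic_def class_C_sum)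

lemma C_per_laplacian: "f \<in> C_per (Suc (Suc m)) P \<Longrightarrow> laplacian f \<in> C_per m P"
  unfolding laplacian_def[abs_def] by (intro C_per_sum C_per_partial)

lemma C_per_one_plus_laplacian: "f \<in> C_per (Suc (Suc m)) P \<Longrightarrow> one_plus_laplacian f \<in> C_per m P"
  unfolding one_plus_laplacian_def by (intro C_per_add C_per_laplacian) (auto elim: C_per_mono)

lemma partial_cmult:
  assumes "f differentiable (at x)"
  shows "partial e (\<lambda>x. c * f x) x = c * partial e f x"
  using assms by (subst partial_mult) auto

lemma laplacian_add:
  assumes "f \<in> C_per 2 P" "g \<in> C_per 2 P"
  shows "laplacian (\<lambda>x. f x + g x) x = laplacian f x + laplacian g x"
proof -
  have d: "f differentiable (at x)" "g differentiable (at x)" for x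
    using assms C_per_differentiable by force+
  have d2: "partial e f differentiable (at x)" "partial e g differentiable (at x)" if "e \<in> Basis" for e x
    using assms that C_per_partial[of _ 1 P e] C_per_differentiable by (force simp: numeral_2_eq_2)+
  have "partial e (\<lambda>x. f x + g x) = (\<lambda>x. partial e f x + partial e g x)" for e
    using d by (auto simp: partial_add)
  then show ?thesis
    using d2 by (simp add: laplacian_def partial_add sum.distrib)
qed

lemma laplacian_cmult:
  assumes "f \<in> C_per 2 P"
  shows "laplacian (\<lambda>x. c * f x) x = c * laplacian f x"
proof -
  have d: "f differentiable (at x)" for x
    using assms C_per_differentiable by force
  have d2: "partial e f differentiable (at x)" if "e \<in> Basis" for e x
    using assms that C_per_partial[of _ 1 P e] C_per_differentiable by (force simp: numeral_2_eq_2)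
  have "partial e (\<lambda>x. c * f x) = (\<lambda>x. c * partial e f x)" for e
    using d by (auto simp: partial_cmult)
  then show ?thesis
    using d2 by (simp add: laplacian_def partial_cmult sum_distrib_left)
qed

lemma laplacian_diff:
  assumes "f \<in> C_per 2 P" "g \<in> C_per 2 P"
  shows "laplacian (\<lambda>x. f x - g x) x = laplacian f x - laplacian g x"
  using laplacian_add[OF assms(1) C_per_cmult[OF assms(2), of "-1"]] laplacian_cmult[OF assms(2), of "-1"]
  by simp

lemma laplacian_const [simp]: "laplacian (\<lambda>_. c) = (\<lambda>_. 0)"
  by (simp add: laplacian_def[abs_def])

section \<open>Integration over the cell and Green's formulas\<close>

definition lattice_coord :: "real^2^2 \<Rightarrow> 2 \<Rightarrow> real^2 \<Rightarrow> real" where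
  "lattice_coord P i x = (matrix_inv P *v x) $ i"

lemma
  assumes "invertible P"
  shows matrix_mult_inv: "P ** matrix_inv P = mat 1"
    and inv_matrix_mult: "matrix_inv P ** P = mat 1"
  using someI_ex[OF assms[unfolded invertible_def]] unfolding matrix_inv_def by auto

lemma lattice_coord_mult:
  assumes "invertible P" shows "lattice_coord P i (P *v s) = s $ i"
  using assms by (simp add: lattice_coord_def matrix_vector_mul_assoc inv_matrix_mult)

lemma linear_lattice_coord: "linear (lattice_coord P i)"
  by (rule linearI) (simp_all add: lattice_coord_def[abs_def] matrix_vector_right_distrib matrix_vector_mult_scaleR)

lemmas lattice_coord_linear_simps =
  linear_add[OF linear_lattice_coord] linear_diff[OF linear_lattice_coord]
  linear_cmul[OF linear_lattice_coord] linear_0[OF linear_lattice_coord]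

lemma continuous_on_lattice_coord [continuous_intros]:
  "continuous_on S f \<Longrightarrow> continuous_on S (\<lambda>x. lattice_coord P i (f x))"
  by (rule continuous_on_compose2[OF linear_continuous_on[of "lattice_coord P i" UNIV]])
     (auto simp: linear_linear linear_lattice_coord)

lemma lattice_coord_column:
  assumes "invertible P" shows "lattice_coord P i (column j P) = (if i = j then 1 else 0)"
  using lattice_coord_mult[OF assms, of i "axis j 1"]
  by (simp add: matrix_vector_mult_basis) (simp add: axis_def)

lemma lattice_expansion:
  assumes "invertible P" shows "x = (\<Sum>i\<in>UNIV. lattice_coord P i x *\<^sub>R column i P)"
proof -
  have "x = P *v (matrix_inv P *v x)"
    using assms by (simp add: matrix_vector_mul_assoc matrix_mult_inv)
  then show ?thesis
    by (simp add: matrix_mult_sum scalar_mult_eq_scaleR lattice_coord_def)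
qed

lemma cell_eq:
  assumes "invertible P"
  shows "cell P = {x. \<forall>i. 0 \<le> lattice_coord P i x \<and> lattice_coord P i x < 1}"
proof (intro equalityI subsetI)
  fix x assume "x \<in> {x. \<forall>i. 0 \<le> lattice_coord P i x \<and> lattice_coord P i x < 1}"
  moreover have "x = P *v (matrix_inv P *v x)"
    using assms by (simp add: matrix_vector_mul_assoc matrix_mult_inv)
  ultimately show "x \<in> cell P"
    unfolding cell_def lattice_coord_def by blast
qed (auto simp: cell_def lattice_coord_mult[OF assms])

lemma cell_borel [measurable]:
  assumes "invertible P" shows "cell P \<in> sets borel"
proof -
  have [measurable]: "lattice_coord P i \<in> borel_measurable borel" for i
    by (intro borel_measurable_continuous_onI continuous_intros)
  have "{x \<in> space borel. \<forall>i. 0 \<le> lattice_coord P i x \<and> lattice_coord P i x < 1} \<in> sets borel"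
    by measurable
  then show ?thesis by (simp add: cell_eq[OF assms])
qed

lemma cell_subset_compact: "\<exists>K. compact K \<and> cell P \<subseteq> K"
proof (intro exI conjI)
  show "compact ((\<lambda>s. P *v s) ` cbox 0 1)"
    by (intro compact_continuous_image linear_continuous_on linear_linear[THEN iffD2] compact_cbox) auto
  show "cell P \<subseteq> (\<lambda>s. P *v s) ` cbox 0 1"
    unfolding cell_def by (intro image_mono) (auto simp: mem_box_cart less_imp_le)
qed

lemma set_integrable_cell:
  fixes f :: "real^2 \<Rightarrow> real"
  assumes "invertible P" "continuous_on UNIV f"
  shows "set_integrable lborel (cell P) f"
proof -
  obtain K where K: "compact K" "cell P \<subseteq> K" using cell_subset_compact by blast
  have "set_integrable lborel K f"
    unfolding set_integrable_def
    by (rule borel_integrable_compact[OF K(1)]) (use assms(2) continuous_on_subset in blast)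
  then show ?thesis
    by (rule set_integrable_subset) (use K assms in auto)
qed

definition cell_integral :: "real^2^2 \<Rightarrow> (real^2 \<Rightarrow> real) \<Rightarrow> real" where
  "cell_integral P f = (LINT x:cell P|lborel. f x)"

lemma cell_integral_lebesgue:
  assumes "invertible P" "continuous_on UNIV f"
  shows "(LINT x:cell P|lebesgue. f x) = cell_integral P f"
  unfolding cell_integral_def set_lebesgue_integral_def
proof (rule integral_completion)
  have [measurable]: "f \<in> borel_measurable borel"
    by (rule borel_measurable_continuous_onI) fact
  show "(\<lambda>x. indicat_real (cell P) x *\<^sub>R f x) \<in> borel_measurable lborel"
    using assms by measurable
qed

lemma L2_inner_eq:
  assumes "invertible P" "continuous_on UNIV f" "continuous_on UNIV g"
  shows "L2_inner P f g = cell_integral P (\<lambda>x. f x * g x)"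
  unfolding L2_inner_def using assms by (intro cell_integral_lebesgue continuous_intros)

lemma cell_integral_cmult [simp]: "cell_integral P (\<lambda>x. c * f x) = c * cell_integral P f"
  unfolding cell_integral_def by simp

lemma cell_integral_zero [simp]: "cell_integral P (\<lambda>_. 0) = 0"
  using cell_integral_cmult[of P 0] by simp

lemma cell_integral_minus [simp]: "cell_integral P (\<lambda>x. - f x) = - cell_integral P f"
  using cell_integral_cmult[of P "-1"] by simp

lemma cell_integral_add:
  assumes "invertible P" "continuous_on UNIV f" "continuous_on UNIV g"
  shows "cell_integral P (\<lambda>x. f x + g x) = cell_integral P f + cell_integral P g"
  unfolding cell_integral_def using assms by (intro set_integral_add set_integrable_cell)

lemma cell_integral_diff:
  assumes "invertible P" "continuous_on UNIV f" "continuous_on UNIV g"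
  shows "cell_integral P (\<lambda>x. f x - g x) = cell_integral P f - cell_integral P g"
  unfolding cell_integral_def using assms by (intro set_integral_diff set_integrable_cell)

lemma cell_integral_sum:
  assumes "invertible P" "\<And>i. i \<in> A \<Longrightarrow> continuous_on UNIV (f i)"
  shows "cell_integral P (\<lambda>x. \<Sum>i\<in>A. f i x) = (\<Sum>i\<in>A. cell_integral P (f i))"
  using assms(2)
proof (induction A rule: infinite_finite_induct)
  case (insert i A)
  then show ?case
    by (simp add: cell_integral_add[OF assms(1)] continuous_on_sum)
qed auto

lemma cell_integral_mono:
  assumes "invertible P" "continuous_on UNIV f" "continuous_on UNIV g" "\<And>x. f x \<le> g x"
  shows "cell_integral P f \<le> cell_integral P g"
  unfolding cell_integral_def using assms by (intro set_integral_mono set_integrable_cell) auto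

lemma cell_integral_nonneg:
  assumes "\<And>x. 0 \<le> f x"
  shows "0 \<le> cell_integral P f"
  unfolding cell_integral_def set_lebesgue_integral_def using assms by (intro integral_nonneg_AE) auto

lemma lborel_integral_translate:
  fixes f :: "'a::euclidean_space \<Rightarrow> real"
  assumes [measurable]: "f \<in> borel_measurable borel"
  shows "(LINT x|lborel. f (x + d)) = (LINT x|lborel. f x)"
proof -
  have "(LINT x|lborel. f x) = (LINT x|distr lborel borel ((+) d). f x)"
    by (simp add: lborel_distr_plus)
  also have "\<dots> = (LINT x|lborel. f (d + x))"
    by (rule integral_distr) auto
  finally show ?thesis by (simp add: add.commute)
qed

text \<open>Moving the cell by a part of a period cuts off a slab on one side and adds its
  translate by the full period on the other, where a periodic function takes the same values.\<close>

lemma cell_integral_translate_column: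
  assumes P: "invertible P" and f: "f \<in> C_per 0 P" and t: "0 \<le> t" "t \<le> 1"
  shows "cell_integral P (\<lambda>x. f (x + t *\<^sub>R column i P)) = cell_integral P f"
proof -
  define c where "c = column i P"
  define L where "L = {x \<in> cell P. lattice_coord P i x < t}"
  define R where "R = {x \<in> cell P. t \<le> lattice_coord P i x}"
  have [measurable]: "lattice_coord P j \<in> borel_measurable borel" for j
    by (intro borel_measurable_continuous_onI continuous_intros)
  have [measurable]: "cell P \<in> sets borel" using P by measurable
  have "L = {x \<in> space borel. x \<in> cell P \<and> lattice_coord P i x < t}" by (auto simp: L_def)
  also have "\<dots> \<in> sets borel" by measurable
  finally have [measurable]: "L \<in> sets borel" .
  have "R = {x \<in> space borel. x \<in> cell P \<and> t \<le> lattice_coord P i x}" by (auto simp: R_def)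
  also have "\<dots> \<in> sets borel" by measurable
  finally have [measurable]: "R \<in> sets borel" .
  have fc: "continuous_on UNIV f" using f by (rule C_per_continuous)
  then have [measurable]: "f \<in> borel_measurable borel" by (rule borel_measurable_continuous_onI)
  have per: "f (x + c) = f x" "f (x - c) = f x" for x
    using f fun_cong[of f f "x - c"] unfolding C_per_def periodic_def c_def
    by (auto, metis diff_add_cancel)
  have coord: "lattice_coord P j (x + s *\<^sub>R c) = lattice_coord P j x + (if j = i then s else 0)" for j x s
    using P by (simp add: lattice_coord_linear_simps lattice_coord_column c_def)
  have ind: "indicator (cell P) (x - t *\<^sub>R c) = (indicator R x + indicator L (x - c) :: real)" for x
  proof -
    have 1: "x - t *\<^sub>R c = x + (-t) *\<^sub>R c" "x - c = x + (-1) *\<^sub>R c" by auto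
    define y where "y = (\<lambda>j. lattice_coord P j x)"
    have a: "x - t *\<^sub>R c \<in> cell P \<longleftrightarrow> (\<forall>j. j \<noteq> i \<longrightarrow> 0 \<le> y j \<and> y j < 1) \<and> t \<le> y i \<and> y i < 1 + t"
      unfolding 1 cell_eq[OF P] mem_Collect_eq coord y_def by (auto split: if_splits)
    have b: "x \<in> R \<longleftrightarrow> (\<forall>j. j \<noteq> i \<longrightarrow> 0 \<le> y j \<and> y j < 1) \<and> t \<le> y i \<and> y i < 1"
      using t unfolding R_def cell_eq[OF P] mem_Collect_eq y_def by (metis order_trans)
    have d: "x - c \<in> L \<longleftrightarrow> (\<forall>j. j \<noteq> i \<longrightarrow> 0 \<le> y j \<and> y j < 1) \<and> 1 \<le> y i \<and> y i < 1 + t"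
      using t unfolding L_def 1 cell_eq[OF P] mem_Collect_eq coord y_def by (auto split: if_splits)
    show ?thesis using a b d t by (auto simp: indicator_def)
  qed
  have int: "set_integrable lborel R f" "set_integrable lborel L f"
    by (rule set_integrable_subset[OF set_integrable_cell[OF P fc]]; auto simp: R_def L_def)+
  have intL: "integrable lborel (\<lambda>x. indicator L (x - c) * f x)"
  proof -
    have "integrable (distr lborel borel ((+) (-c))) (\<lambda>x. indicator L x * f x)"
      using int(2) by (simp add: lborel_distr_plus set_integrable_def)
    then have "integrable lborel (\<lambda>x. indicator L (-c + x) * f (- c + x))"
      by (subst (asm) integrable_distr_eq) auto
    then show ?thesis using per by (simp add: add.commute[of "-c"])
  qed
  have "cell_integral P (\<lambda>x. f (x + t *\<^sub>R c)) = (LINT x|lborel. indicator (cell P) ((x + t *\<^sub>R c) - t *\<^sub>R c) * f (x + t *\<^sub>R c))"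
    by (simp add: cell_integral_def set_lebesgue_integral_def)
  also have "\<dots> = (LINT x|lborel. indicator (cell P) (x - t *\<^sub>R c) * f x)"
    by (rule lborel_integral_translate[of "\<lambda>x. indicator (cell P) (x - t *\<^sub>R c) * f x"]) measurable
  also have "\<dots> = (LINT x|lborel. indicator R x * f x + indicator L (x - c) * f x)"
    by (simp add: ind algebra_simps)
  also have "\<dots> = (LINT x|lborel. indicator R x * f x) + (LINT x|lborel. indicator L (x - c) * f x)"
    using int intL by (intro Bochner_Integration.integral_add) (auto simp: set_integrable_def)
  also have "(LINT x|lborel. indicator L (x - c) * f x) = (LINT x|lborel. indicator L (x - c) * f (x - c))"
    by (simp add: per)
  also have "\<dots> = (LINT x|lborel. indicator L x * f x)"
    using lborel_integral_translate[of "\<lambda>x. indicator L x * f x" "-c"] by simp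
  also have "(LINT x|lborel. indicator R x * f x) + \<dots> = (LINT x|lborel. indicator R x * f x + indicator L x * f x)"
    using int by (intro Bochner_Integration.integral_add[symmetric]) (auto simp: set_integrable_def)
  also have "\<dots> = (LINT x|lborel. indicator (cell P) x * f x)"
    by (rule Bochner_Integration.integral_cong) (auto simp: L_def R_def indicator_def)
  also have "\<dots> = cell_integral P f"
    by (simp add: cell_integral_def set_lebesgue_integral_def)
  finally show ?thesis by (simp add: c_def)
qed

lemma partial_linear:
  assumes "f differentiable (at x)"
  shows "linear (\<lambda>e. partial e f x)"
  using assms unfolding partial_def frechet_derivative_works
  using has_derivative_linear by blast

lemma partial_expand:
  assumes "f differentiable (at x)"
  shows "partial h f x = (\<Sum>e\<in>Basis. (h \<bullet> e) * partial e f x)"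
  using has_derivative_partial[OF assms] by (rule partial_eqI)

lemma C_per_partial_direction:
  assumes "f \<in> C_per (Suc m) P"
  shows "partial h f \<in> C_per m P"
proof -
  have "partial h f = (\<lambda>x. \<Sum>e\<in>Basis. (h \<bullet> e) * partial e f x)"
    using assms by (intro ext partial_expand C_per_differentiable) auto
  then show ?thesis
    using C_per_partial[OF assms] by (simp add: C_per_sum C_per_cmult)
qed

text \<open>The difference quotients of \<open>f\<close> in the direction of a period integrate to zero by
  translation invariance. They are bounded by the mean value theorem and converge to the
  directional derivative, so dominated convergence applies.\<close>

lemma cell_integral_partial_column:
  assumes P: "invertible P" and f: "f \<in> C_per 1 P"
  shows "cell_integral P (partial (column i P) f) = 0"
proof -
  define c where "c = column i P"
  define g where "g = partial c f"
  define t where "t n = 1 / real (Suc n)" for n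
  have diff: "f differentiable (at x)" for x using f C_per_differentiable by force
  have fc: "continuous_on UNIV f" using f by (rule C_per_continuous)
  have gc: "continuous_on UNIV g"
    using C_per_partial_direction[of f 0 P c] f by (simp add: g_def C_per_continuous)
  have deriv: "((\<lambda>s. f (x + s *\<^sub>R c)) has_real_derivative g (x + s *\<^sub>R c)) (at s)" for x s
  proof -
    have "(f has_derivative frechet_derivative f (at (x + s *\<^sub>R c))) (at (x + s *\<^sub>R c))"
      using diff frechet_derivative_works by blast
    moreover have "((\<lambda>s. x + s *\<^sub>R c) has_derivative (\<lambda>h. h *\<^sub>R c)) (at s)"
      by (auto intro!: derivative_eq_intros)
    ultimately have "((\<lambda>s. f (x + s *\<^sub>R c)) has_derivative (\<lambda>h. frechet_derivative f (at (x + s *\<^sub>R c)) (h *\<^sub>R c))) (at s)"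
      using has_derivative_compose by blast
    moreover have "frechet_derivative f (at (x + s *\<^sub>R c)) (h *\<^sub>R c) = g (x + s *\<^sub>R c) * h" for h
      using linear_cmul[OF partial_linear[OF diff, of "x + s *\<^sub>R c"], of h c]
      by (simp add: g_def partial_def)
    ultimately show ?thesis by (simp add: has_field_derivative_def)
  qed
  obtain K where K: "compact K" "cell P \<subseteq> K" using cell_subset_compact by blast
  have K': "compact ((\<lambda>(x, s). x + s *\<^sub>R c) ` (K \<times> {0..1}))"
    by (rule compact_continuous_image[OF _ compact_Times[OF K(1) compact_Icc]])
      (auto simp: case_prod_beta intro!: continuous_intros)
  have "compact (g ` ((\<lambda>(x, s). x + s *\<^sub>R c) ` (K \<times> {0..1})))"
    by (rule compact_continuous_image[OF continuous_on_subset[OF gc] K']) simp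
  from compact_imp_bounded[OF this] obtain M
    where "\<forall>y \<in> g ` ((\<lambda>(x, s). x + s *\<^sub>R c) ` (K \<times> {0..1})). norm y \<le> M"
    unfolding bounded_iff by blast
  then have M: "\<bar>g (x + s *\<^sub>R c)\<bar> \<le> M" if "x \<in> K" "s \<in> {0..1}" for x s
    using that by auto
  have tpos: "0 < t n" "t n \<le> 1" for n by (auto simp: t_def)
  have tne: "t n \<noteq> 0" for n using tpos(1)[of n] by simp
  define q where "q n x = (f (x + t n *\<^sub>R c) - f x) / t n" for n x
  have qb: "\<bar>q n x\<bar> \<le> M" if "x \<in> cell P" for n x
  proof -
    obtain s where s: "0 < s" "s < t n" "f (x + t n *\<^sub>R c) - f (x + 0 *\<^sub>R c) = (t n - 0) * g (x + s *\<^sub>R c)"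
      using MVT2[of 0 "t n" "\<lambda>s. f (x + s *\<^sub>R c)" "\<lambda>s. g (x + s *\<^sub>R c)"] deriv tpos by auto
    then have "q n x = g (x + s *\<^sub>R c)" using tpos[of n] by (simp add: q_def field_simps)
    then show ?thesis using M[of x s] s tpos[of n] that K by auto
  qed
  have qlim: "(\<lambda>n. q n x) \<longlonglongrightarrow> g x" for x
  proof -
    have t0: "filterlim t (at 0) sequentially"
    proof -
      have "t = (\<lambda>n. inverse (real (Suc n)))"
        by (simp add: t_def[abs_def] inverse_eq_divide)
      then have "t \<longlonglongrightarrow> 0"
        using LIMSEQ_inverse_real_of_nat by simp
      then show ?thesis
        using tne by (auto simp: filterlim_at intro!: always_eventually)
    qed
    have "((\<lambda>h. (f (x + (0 + h) *\<^sub>R c) - f (x + 0 *\<^sub>R c)) / h) \<longlongrightarrow> g (x + 0 *\<^sub>R c)) (at 0)"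
      using deriv[of x 0] unfolding DERIV_def .
    from filterlim_compose[OF this t0] show ?thesis by (simp add: q_def)
  qed
  have [measurable]: "f \<in> borel_measurable borel" "g \<in> borel_measurable borel" "cell P \<in> sets borel"
    using fc gc P by (auto intro: borel_measurable_continuous_onI)
  have [measurable]: "q n \<in> borel_measurable borel" for n unfolding q_def by measurable
  have lim: "(\<lambda>n. LINT x|lborel. indicator (cell P) x * q n x) \<longlonglongrightarrow> (LINT x|lborel. indicator (cell P) x * g x)"
  proof (rule integral_dominated_convergence[where w = "\<lambda>x. indicator (cell P) x * M"])
    show "integrable lborel (\<lambda>x. indicat_real (cell P) x * M)"
      using set_integrable_cell[OF P, of "\<lambda>_. M"] by (simp add: set_integrable_def)
  qed (use qb in \<open>auto simp: indicator_def intro!: tendsto_intros qlim always_eventually\<close>)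
  have q0: "(LINT x|lborel. indicator (cell P) x * q n x) = 0" for n
  proof -
    have "cell_integral P (\<lambda>x. f (x + t n *\<^sub>R c) - f x) =
        cell_integral P (\<lambda>x. f (x + t n *\<^sub>R c)) - cell_integral P f"
      by (intro cell_integral_diff P fc continuous_on_compose2[OF fc]) (auto intro!: continuous_intros)
    also have "\<dots> = 0"
      using cell_integral_translate_column[OF P, of f "t n" i] C_per_imp_0[OF f] tpos[of n]
      by (simp add: c_def)
    finally have "1 / t n * cell_integral P (\<lambda>x. f (x + t n *\<^sub>R c) - f x) = 0" by simp
    then have "cell_integral P (\<lambda>x. 1 / t n * (f (x + t n *\<^sub>R c) - f x)) = 0"
      by (simp only: cell_integral_cmult)
    then show ?thesis
      by (simp add: q_def cell_integral_def set_lebesgue_integral_def)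
  qed
  have "(LINT x|lborel. indicator (cell P) x * g x) = 0"
    by (rule LIMSEQ_unique[OF lim[unfolded q0] tendsto_const])
  then show ?thesis by (simp add: g_def c_def cell_integral_def set_lebesgue_integral_def)
qed

text \<open>The two periods span the plane, so every direction is a combination of them.\<close>

lemma cell_integral_partial:
  assumes P: "invertible P" and f: "f \<in> C_per 1 P"
  shows "cell_integral P (partial h f) = 0"
proof -
  have diff: "f differentiable (at x)" for x using f C_per_differentiable by force
  have cont: "continuous_on UNIV (partial h f)" for h
    using C_per_partial_direction[of f 0 P h] f by (simp add: C_per_continuous)
  have "partial h f = (\<lambda>x. \<Sum>i\<in>UNIV. lattice_coord P i h * partial (column i P) f x)"
    by (rule ext, subst lattice_expansion[OF P, of h])
      (simp add: linear_sum[OF partial_linear[OF diff]] linear_cmul[OF partial_linear[OF diff]])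
  then have "cell_integral P (partial h f)
      = cell_integral P (\<lambda>x. \<Sum>i\<in>UNIV. lattice_coord P i h * partial (column i P) f x)"
    by (rule arg_cong)
  also have "\<dots> = (\<Sum>i\<in>UNIV. lattice_coord P i h * cell_integral P (partial (column i P) f))"
    by (subst cell_integral_sum[OF P]) (simp_all add: cont continuous_on_mult)
  finally have "cell_integral P (partial h f)
      = (\<Sum>i\<in>UNIV. lattice_coord P i h * cell_integral P (partial (column i P) f))" .
  then show ?thesis by (simp add: cell_integral_partial_column[OF P f])
qed

text \<open>This is the vanishing of the integral of the divergence of \<open>f \<nabla>g\<close>.\<close>

lemma green_first:
  assumes P: "invertible P" and f: "f \<in> C_per 1 P" and g: "g \<in> C_per 2 P"
  shows "cell_integral P (\<lambda>x. f x * laplacian g x)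
     = - cell_integral P (\<lambda>x. \<Sum>e\<in>Basis. partial e f x * partial e g x)"
proof -
  have pf: "partial e f \<in> C_per 0 P" if "e \<in> Basis" for e
    using C_per_partial[of f 0 P e] f that by simp
  have pg: "partial e g \<in> C_per 1 P" if "e \<in> Basis" for e
    using C_per_partial[of g 1 P e] g that by (simp add: numeral_2_eq_2)
  have ppg: "partial e (partial e g) \<in> C_per 0 P" if "e \<in> Basis" for e
    using C_per_partial[of _ 0 P e] pg that by simp
  note cont = f[THEN C_per_continuous] pf[THEN C_per_continuous] pg[THEN C_per_continuous] ppg[THEN C_per_continuous]
  have 1: "cell_integral P (\<lambda>x. f x * partial e (partial e g) x) = - cell_integral P (\<lambda>x. partial e f x * partial e g x)"
    if e: "e \<in> Basis" for e
  proof -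
    have "cell_integral P (partial e (\<lambda>x. f x * partial e g x)) = 0"
      by (intro cell_integral_partial P C_per_mult f pg e)
    moreover have "partial e (\<lambda>x. f x * partial e g x) = (\<lambda>x. f x * partial e (partial e g) x + partial e f x * partial e g x)"
      using f pg[OF e] by (intro ext partial_mult) (auto intro: C_per_differentiable)
    ultimately show ?thesis
      using cont e by (simp add: cell_integral_add[OF P] continuous_on_mult)
  qed
  show ?thesis
    unfolding laplacian_def sum_distrib_left
    using cont by (simp add: cell_integral_sum[OF P] continuous_on_mult 1 sum_negf)
qed

lemma green_second:
  assumes P: "invertible P" and f: "f \<in> C_per 2 P" and g: "g \<in> C_per 2 P"
  shows "cell_integral P (\<lambda>x. f x * laplacian g x) = cell_integral P (\<lambda>x. laplacian f x * g x)"
  using green_first[OF P C_per_mono[OF f] g] green_first[OF P C_per_mono[OF g] f]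
  by (simp add: mult.commute)

lemma cell_integral_laplacian:
  assumes P: "invertible P" and g: "g \<in> C_per 2 P"
  shows "cell_integral P (laplacian g) = 0"
  using green_first[OF P C_per_const[of 1] g] by simp

section \<open>Continuous periodic functions and their cell representatives\<close>

lemma periodic_shift_int:
  assumes "periodic P f" shows "f (x + of_int n *\<^sub>R column i P) = f x"
proof -
  have nat: "f (y + real m *\<^sub>R column i P) = f y" for y m
  proof (induction m)
    case (Suc m)
    have "f (y + real (Suc m) *\<^sub>R column i P) = f ((y + real m *\<^sub>R column i P) + column i P)"
      by (simp add: algebra_simps)
    also have "\<dots> = f y" using assms Suc by (simp only: periodic_def)
    finally show ?case .
  qed simp
  show ?thesis
  proof (cases "0 \<le> n")
    case True then show ?thesis using nat[of x "nat n"] by simp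
  next
    case False
    have "f (x + of_int n *\<^sub>R column i P)
        = f ((x + of_int n *\<^sub>R column i P) + real (nat (- n)) *\<^sub>R column i P)"
      by (rule nat[symmetric])
    also have "(x + of_int n *\<^sub>R column i P) + real (nat (- n)) *\<^sub>R column i P = x"
      using False by simp
    finally show ?thesis .
  qed
qed

lemma periodic_lattice_coord_eq:
  assumes P: "invertible P" and f: "periodic P f"
    and xy: "\<And>i. lattice_coord P i x - lattice_coord P i y \<in> \<int>"
  shows "f x = f y"
proof -
  obtain n where n: "\<And>i. lattice_coord P i x - lattice_coord P i y = of_int (n i)"
    using xy unfolding Ints_def image_iff by metis
  have "f (y + (\<Sum>i\<in>A. of_int (n i) *\<^sub>R column i P)) = f y" for A
  proof (induction A rule: infinite_finite_induct)
    case (insert i A)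
    then have "f (y + (\<Sum>i\<in>insert i A. of_int (n i) *\<^sub>R column i P))
        = f ((y + (\<Sum>i\<in>A. of_int (n i) *\<^sub>R column i P)) + of_int (n i) *\<^sub>R column i P)"
      by (simp add: algebra_simps)
    then show ?case using insert by (simp only: periodic_shift_int[OF f])
  qed auto
  moreover have "x = y + (\<Sum>i\<in>UNIV. of_int (n i) *\<^sub>R column i P)"
    using lattice_expansion[OF P, of "x - y"]
    by (simp add: lattice_coord_linear_simps n algebra_simps)
  ultimately show ?thesis by metis
qed

lemma cell_representative:
  assumes P: "invertible P"
  obtains y where "y \<in> cell P" "\<And>i. lattice_coord P i x - lattice_coord P i y \<in> \<int>"
proof
  let ?s = "\<chi> i. frac (lattice_coord P i x)"
  show "P *v ?s \<in> cell P" unfolding cell_def by (auto simp: frac_lt_1)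
  show "lattice_coord P i x - lattice_coord P i (P *v ?s) \<in> \<int>" for i
    by (simp add: lattice_coord_mult[OF P] frac_def)
qed

text \<open>The set of interior points of the cell where \<open>f\<close> does not vanish is open and null, hence
  empty. The half-open cell also contains boundary points, which are reached along the
  segment to the centre of the cell.\<close>

lemma cell_integral_square_eq_0:
  assumes P: "invertible P" and f: "f \<in> C_per 0 P" and 0: "cell_integral P (\<lambda>x. f x * f x) = 0"
  shows "f x = 0"
proof -
  have fc: "continuous_on UNIV f" and per: "periodic P f"
    using f by (auto simp: C_per_def)
  define U where "U = {x. (\<forall>i. 0 < lattice_coord P i x \<and> lattice_coord P i x < 1) \<and> f x \<noteq> 0}"
  have oU: "open U"
  proof -
    have "U = (\<Inter>i. {x. 0 < lattice_coord P i x} \<inter> {x. lattice_coord P i x < 1}) \<inter> {x. f x \<noteq> 0}"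
      by (auto simp: U_def)
    moreover have "open {x. f x \<noteq> 0}"
      using open_Collect_neq[OF fc continuous_on_const] by simp
    ultimately show ?thesis
      by (auto intro!: open_Int open_INT open_Collect_less continuous_intros)
  qed
  have AE: "AE x in lborel. indicator (cell P) x *\<^sub>R (f x * f x) = 0"
    using 0 set_integrable_cell[OF P, of "\<lambda>x. f x * f x"] fc
    unfolding cell_integral_def set_lebesgue_integral_def set_integrable_def
    by (subst (asm) integral_nonneg_eq_0_iff_AE) (auto intro: continuous_intros)
  have "U \<subseteq> cell P"
    unfolding U_def cell_eq[OF P] using less_imp_le by blast
  then have off: "indicator (cell P) x *\<^sub>R (f x * f x) = 0 \<longrightarrow> x \<notin> U" for x
    by (auto simp: U_def)
  have "AE x in lborel. x \<notin> U"
    by (rule AE_mp[OF AE AE_I2[OF off]])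
  then have "U \<in> null_sets lborel"
    using oU by (subst AE_iff_null_sets) auto
  then have "negligible U"
    unfolding negligible_iff_null_sets by (rule null_sets_completionI)
  then have "U = {}" using open_not_negligible[OF oU] by blast
  obtain y where y: "y \<in> cell P" "\<And>i. lattice_coord P i x - lattice_coord P i y \<in> \<int>"
    using cell_representative[OF P] by blast
  define z where "z = P *v (\<chi> i. 1/2)"
  define t where "t n = inverse (real (Suc n))" for n
  have t: "0 < t n" "t n \<le> 1" for n by (auto simp: t_def field_simps)
  have path: "f (y + t n *\<^sub>R (z - y)) = 0" for n
  proof -
    have "0 < (1 - t n) * lattice_coord P i y + t n / 2 \<and> (1 - t n) * lattice_coord P i y + t n / 2 < 1" for i
    proof -
      have "0 \<le> lattice_coord P i y" "lattice_coord P i y < 1" using y(1) by (auto simp: cell_eq[OF P])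
      then have "0 \<le> (1 - t n) * lattice_coord P i y"
        using t(2)[of n] by (intro mult_nonneg_nonneg) auto
      moreover have "(1 - t n) * lattice_coord P i y \<le> 1 - t n"
        using mult_left_mono[of "lattice_coord P i y" 1 "1 - t n"] t(2)[of n] \<open>lattice_coord P i y < 1\<close> by simp
      ultimately show ?thesis using t(1)[of n] by (intro conjI) linarith+
    qed
    then have "0 < lattice_coord P i (y + t n *\<^sub>R (z - y)) \<and> lattice_coord P i (y + t n *\<^sub>R (z - y)) < 1" for i
      by (simp add: lattice_coord_linear_simps z_def lattice_coord_mult[OF P] algebra_simps)
    then show ?thesis using \<open>U = {}\<close> by (auto simp: U_def)
  qed
  have lim: "(\<lambda>n. f (y + t n *\<^sub>R (z - y))) \<longlonglongrightarrow> f (y + 0 *\<^sub>R (z - y))"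
  proof (rule continuous_on_tendsto_compose[OF fc])
    show "(\<lambda>n. y + t n *\<^sub>R (z - y)) \<longlonglongrightarrow> y + 0 *\<^sub>R (z - y)"
      unfolding t_def by (intro tendsto_intros LIMSEQ_inverse_real_of_nat)
  qed auto
  have "f y = 0"
    using LIMSEQ_unique[OF lim[unfolded path] tendsto_const] by simp
  with periodic_lattice_coord_eq[OF P per y(2)] show ?thesis by simp
qed

definition cell_area :: "real^2^2 \<Rightarrow> real" where
  "cell_area P = cell_integral P (\<lambda>_. 1)"

lemma cell_area_pos:
  assumes "invertible P" shows "0 < cell_area P"
proof -
  have "cell_area P \<noteq> 0"
    using cell_integral_square_eq_0[OF assms C_per_const[of 1]] by (auto simp: cell_area_def)
  moreover have "0 \<le> cell_area P"
    unfolding cell_area_def by (rule cell_integral_nonneg) simp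
  ultimately show ?thesis by simp
qed

lemma cell_integral_const [simp]: "cell_integral P (\<lambda>_. c) = c * cell_area P"
  using cell_integral_cmult[of P c "\<lambda>_. 1"] by (simp add: cell_area_def)

section \<open>Plane waves on the cell\<close>

text \<open>The Hartley kernel. The functions \<open>cas (\<xi>\<^sub>m \<bullet> x)\<close>, with \<open>m\<close> ranging over all of \<open>\<int>\<^sup>2\<close>, are a
  real orthogonal basis of eigenfunctions of the Laplacian. Unlike cosines and sines they need
  no choice of one wave vector from each pair \<open>\<plusminus>\<xi>\<close>, and unlike exponentials they stay within
  the real-valued functions.\<close>

definition cas :: "real \<Rightarrow> real" where "cas t = cos t + sin t"

text \<open>The vectors of \<open>2\<pi>\<close> times the dual lattice: the rows of the inverse of \<open>P\<close> are the basis dual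
  to the periods.\<close>

definition wave :: "real^2^2 \<Rightarrow> int \<times> int \<Rightarrow> real^2" where
  "wave P m = (2 * pi) *\<^sub>R (of_int (fst m) *\<^sub>R (matrix_inv P $ 1) + of_int (snd m) *\<^sub>R (matrix_inv P $ 2))"

lemma inner_wave:
  "wave P m \<bullet> x = 2 * pi * (of_int (fst m) * lattice_coord P 1 x + of_int (snd m) * lattice_coord P 2 x)"
  by (simp add: wave_def lattice_coord_def matrix_vector_mul_component inner_add_left)

lemma wave_add: "wave P (m + l) = wave P m + wave P l"
  by (simp add: wave_def algebra_simps)

lemma wave_minus: "wave P (- m) = - wave P m"
  by (simp add: wave_def algebra_simps)

lemma wave_diff: "wave P (m - l) = wave P m - wave P l"
  using wave_add[of P m "- l"] by (simp add: wave_minus)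

lemma wave_0 [simp]: "wave P 0 = 0"
  by (simp add: wave_def)

lemma periodic_cas_wave:
  assumes P: "invertible P" shows "periodic P (\<lambda>x. cas (wave P m \<bullet> x))"
  unfolding periodic_def
proof (intro allI)
  fix x i
  have "\<exists>n::int. wave P m \<bullet> column i P = 2 * pi * of_int n"
    unfolding inner_wave lattice_coord_column[OF P]
    by (rule exI[of _ "(if i = 1 then fst m else 0) + (if i = 2 then snd m else 0)"]) auto
  then obtain n :: int where "wave P m \<bullet> column i P = 2 * pi * of_int n" ..
  then have *: "wave P m \<bullet> (x + column i P) = wave P m \<bullet> x + 2 * pi * of_int n"
    by (simp add: inner_add_right)
  have "sin (2 * pi * of_int n) = 0" "cos (2 * pi * of_int n) = 1"
    by (simp_all add: sin_integer_2pi cos_integer_2pi)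
  then show "cas (wave P m \<bullet> (x + column i P)) = cas (wave P m \<bullet> x)"
    unfolding * cas_def sin_add cos_add by simp
qed

lemma abs_cas_le: "\<bar>cas t\<bar> \<le> 2"
  using abs_cos_le_one[of t] abs_sin_le_one[of t] unfolding cas_def by linarith

lemma has_derivative_cas_inner:
  "((\<lambda>x. k * cas (z \<bullet> x)) has_derivative (\<lambda>h. k * (z \<bullet> h) * cas ((- z) \<bullet> x))) (at x)"
  unfolding cas_def by (auto intro!: derivative_eq_intros simp: algebra_simps)

lemma partial_cas: "partial e (\<lambda>x. k * cas (z \<bullet> x)) = (\<lambda>x. (k * (z \<bullet> e)) * cas ((- z) \<bullet> x))"
  by (rule ext, rule partial_eqI[OF has_derivative_cas_inner])

lemma continuous_on_cas [continuous_intros]: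
  fixes f :: "'a::t2_space \<Rightarrow> real"
  shows "continuous_on S f \<Longrightarrow> continuous_on S (\<lambda>x. cas (f x))"
  unfolding cas_def by (intro continuous_intros)

lemma class_C_cas: "class_C m (\<lambda>x. k * cas (z \<bullet> x))"
proof (induction m arbitrary: k z)
  case 0
  show ?case by (auto intro!: continuous_intros)
next
  case (Suc m)
  have "(\<lambda>x. k * cas (z \<bullet> x)) differentiable (at x)" for x
    using has_derivative_cas_inner differentiable_def by blast
  then show ?case using Suc by (simp only: class_C.simps partial_cas) simp
qed

lemma cas_wave_C_per: "invertible P \<Longrightarrow> (\<lambda>x. cas (wave P m \<bullet> x)) \<in> C_per n P"
  using class_C_cas[of n 1] periodic_cas_wave by (simp add: C_per_def)

lemma continuous_cas_inner [simp]: "continuous_on S (\<lambda>x. cas (z \<bullet> x))"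
  by (intro continuous_intros)

lemma laplacian_cas: "laplacian (\<lambda>x. cas (z \<bullet> x)) = (\<lambda>x. - (norm z)\<^sup>2 * cas (z \<bullet> x))"
proof
  fix x
  have "partial e (partial e (\<lambda>x. cas (z \<bullet> x))) = (\<lambda>x. - ((z \<bullet> e) * (z \<bullet> e)) * cas (z \<bullet> x))" for e
    using partial_cas[of e 1 z] partial_cas[of e "z \<bullet> e" "- z"] by simp
  then show "laplacian (\<lambda>x. cas (z \<bullet> x)) x = - (norm z)\<^sup>2 * cas (z \<bullet> x)"
    by (simp add: laplacian_def power2_norm_eq_inner euclidean_inner[of z z] sum_distrib_right sum_negf)
qed

lemma wave_eq_0_iff:
  assumes P: "invertible P" shows "wave P m = 0 \<longleftrightarrow> m = 0"
proof
  assume "wave P m = 0"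
  then have "wave P m \<bullet> column i P = 0" for i by simp
  from this[of 1] this[of 2] show "m = 0"
    by (simp add: inner_wave lattice_coord_column[OF P] prod_eq_iff)
qed simp

text \<open>A nonconstant wave is a multiple of its own Laplacian, which integrates to zero.\<close>

lemma cell_integral_cas_wave:
  assumes P: "invertible P"
  shows "cell_integral P (\<lambda>x. cas (wave P m \<bullet> x)) = (if m = 0 then cell_area P else 0)"
proof (cases "m = 0")
  case False
  have "cell_integral P (laplacian (\<lambda>x. cas (wave P m \<bullet> x))) = 0"
    by (intro cell_integral_laplacian P cas_wave_C_per)
  then have "(norm (wave P m))\<^sup>2 * cell_integral P (\<lambda>x. cas (wave P m \<bullet> x)) = 0"
    unfolding laplacian_cas cell_integral_cmult by simp
  then show ?thesis using False by (simp add: wave_eq_0_iff[OF P])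
qed (simp add: cas_def)

text \<open>Since \<open>cas a * cas b = cos (a - b) + sin (a + b)\<close>, and a sine integrates to zero over
  the cell for every wave vector, only \<open>m = l\<close> contributes.\<close>

lemma cas_wave_orthogonal:
  assumes P: "invertible P"
  shows "cell_integral P (\<lambda>x. cas (wave P m \<bullet> x) * cas (wave P l \<bullet> x)) = (if m = l then cell_area P else 0)"
proof -
  have half: "cell_integral P (\<lambda>x. f x / 2) = cell_integral P f / 2" for f
    using cell_integral_cmult[of P "1/2" f] by simp
  have "cas a * cas b = 1/2 * (cas (a - b) + cas (-(a - b))) + 1/2 * (cas (a + b) - cas (-(a + b)))" for a b
    unfolding cas_def by (simp add: cos_add cos_diff sin_add sin_diff algebra_simps)
  then have "cas (wave P m \<bullet> x) * cas (wave P l \<bullet> x)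
     = 1/2 * (cas (wave P (m - l) \<bullet> x) + cas (wave P (-(m - l)) \<bullet> x))
     + 1/2 * (cas (wave P (m + l) \<bullet> x) - cas (wave P (-(m + l)) \<bullet> x))" for x
    by (simp only: wave_add wave_minus wave_diff inner_add_left inner_diff_left inner_minus_left)
  then have "cell_integral P (\<lambda>x. cas (wave P m \<bullet> x) * cas (wave P l \<bullet> x))
     = 1/2 * (cell_integral P (\<lambda>x. cas (wave P (m - l) \<bullet> x)) + cell_integral P (\<lambda>x. cas (wave P (-(m - l)) \<bullet> x)))
     + 1/2 * (cell_integral P (\<lambda>x. cas (wave P (m + l) \<bullet> x)) - cell_integral P (\<lambda>x. cas (wave P (-(m + l)) \<bullet> x)))"
    by (simp add: cell_integral_add[OF P] cell_integral_diff[OF P] continuous_on_add continuous_on_diff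
        continuous_on_mult continuous_on_divide half del: minus_diff_eq)
  moreover have "-(m + l) = 0 \<longleftrightarrow> m + l = 0" by (simp only: neg_equal_0_iff_equal)
  moreover have "-(m - l) = 0 \<longleftrightarrow> m - l = 0" by (simp only: neg_equal_0_iff_equal)
  ultimately show ?thesis
    by (simp only: cell_integral_cas_wave[OF P]) auto
qed

lemma bessel_wave:
  assumes P: "invertible P" and f: "continuous_on UNIV f" and F: "finite F"
  shows "(\<Sum>m\<in>F. (cell_integral P (\<lambda>x. f x * cas (wave P m \<bullet> x)))\<^sup>2)
     \<le> cell_area P * cell_integral P (\<lambda>x. f x * f x)"
proof -
  define V where "V = cell_area P"
  have V: "0 < V" using P by (simp add: V_def cell_area_pos)
  define e where "e m x = cas (wave P m \<bullet> x)" for m x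
  define c where "c m = cell_integral P (\<lambda>x. f x * e m x)" for m
  define s where "s x = (\<Sum>m\<in>F. c m * e m x)" for x
  have ec: "continuous_on UNIV (e m)" for m unfolding e_def by simp
  have sc: "continuous_on UNIV s" unfolding s_def using ec by (intro continuous_intros)
  have fs: "cell_integral P (\<lambda>x. f x * s x) = (\<Sum>m\<in>F. (c m)\<^sup>2)"
  proof -
    have "(\<lambda>x. f x * s x) = (\<lambda>x. \<Sum>m\<in>F. c m * (f x * e m x))"
      by (simp add: s_def sum_distrib_left mult.left_commute)
    then show ?thesis
      using ec f by (simp add: cell_integral_sum[OF P] continuous_on_mult c_def[symmetric] power2_eq_square)
  qed
  have es: "cell_integral P (\<lambda>x. e m x * s x) = c m * V" if "m \<in> F" for m
  proof -
    have "(\<lambda>x. e m x * s x) = (\<lambda>x. \<Sum>l\<in>F. c l * (e m x * e l x))"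
      by (simp add: s_def sum_distrib_left mult.left_commute)
    then have "cell_integral P (\<lambda>x. e m x * s x) = (\<Sum>l\<in>F. c l * (if m = l then V else 0))"
      using ec by (simp add: cell_integral_sum[OF P] continuous_on_mult)
        (simp only: e_def cas_wave_orthogonal[OF P] V_def)
    then show ?thesis using that F by (simp add: if_distrib cong: if_cong)
  qed
  have ss: "cell_integral P (\<lambda>x. s x * s x) = V * (\<Sum>m\<in>F. (c m)\<^sup>2)"
  proof -
    have "(\<lambda>x. s x * s x) = (\<lambda>x. \<Sum>m\<in>F. c m * (e m x * s x))"
      by (rule ext, subst (1) s_def) (simp add: sum_distrib_right mult.assoc)
    then have "cell_integral P (\<lambda>x. s x * s x) = (\<Sum>m\<in>F. c m * (c m * V))"
      using ec sc by (simp add: cell_integral_sum[OF P] continuous_on_mult es)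
    then show ?thesis by (simp add: sum_distrib_left power2_eq_square mult_ac)
  qed
  have "0 \<le> cell_integral P (\<lambda>x. (V * f x - s x) * (V * f x - s x))"
    by (rule cell_integral_nonneg) simp
  also have "(\<lambda>x. (V * f x - s x) * (V * f x - s x)) = (\<lambda>x. V\<^sup>2 * (f x * f x) - (2 * V) * (f x * s x) + s x * s x)"
    by (auto simp: algebra_simps power2_eq_square)
  also have "cell_integral P \<dots> = V\<^sup>2 * cell_integral P (\<lambda>x. f x * f x)
      - (2 * V) * cell_integral P (\<lambda>x. f x * s x) + cell_integral P (\<lambda>x. s x * s x)"
    using f sc by (simp add: cell_integral_add[OF P] cell_integral_diff[OF P] continuous_on_add continuous_on_diff
        continuous_on_mult)
  also have "\<dots> = V * (V * cell_integral P (\<lambda>x. f x * f x) - (\<Sum>m\<in>F. (c m)\<^sup>2))"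
    unfolding fs ss by (simp add: algebra_simps power2_eq_square)
  finally have "0 \<le> V * cell_integral P (\<lambda>x. f x * f x) - (\<Sum>m\<in>F. (c m)\<^sup>2)"
    using V by (simp add: zero_le_mult_iff)
  then show ?thesis by (simp add: c_def V_def e_def)
qed

section \<open>Series of plane waves\<close>

lemma summable_cas_series:
  assumes "summable (\<lambda>n. \<bar>k n\<bar>)"
  shows "summable (\<lambda>n. \<bar>k n * cas (t n)\<bar>)" "summable (\<lambda>n. k n * cas (t n))"
proof -
  have "summable (\<lambda>n. 2 * \<bar>k n\<bar>)" using assms by (rule summable_mult)
  then show "summable (\<lambda>n. \<bar>k n * cas (t n)\<bar>)"
    by (rule summable_comparison_test')
      (use abs_cas_le in \<open>auto simp: abs_mult mult.commute[of 2] intro!: mult_left_mono\<close>)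
  then show "summable (\<lambda>n. k n * cas (t n))" by (rule summable_rabs_cancel)
qed

lemma continuous_cas_series:
  fixes z :: "nat \<Rightarrow> real^2"
  assumes "summable (\<lambda>n. \<bar>k n\<bar>)"
  shows "continuous_on UNIV (\<lambda>x. \<Sum>n. k n * cas (z n \<bullet> x))"
proof -
  have "uniform_limit UNIV (\<lambda>n x. \<Sum>i<n. k i * cas (z i \<bullet> x)) (\<lambda>x. \<Sum>n. k n * cas (z n \<bullet> x)) sequentially"
  proof (rule Weierstrass_m_test)
    show "norm (k n * cas (z n \<bullet> x)) \<le> 2 * \<bar>k n\<bar>" for n x
      using abs_cas_le by (auto simp: abs_mult mult.commute[of 2] intro!: mult_left_mono)
    show "summable (\<lambda>n. 2 * \<bar>k n\<bar>)" using assms by (rule summable_mult)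
  qed
  then show ?thesis
    by (rule uniform_limit_theorem[rotated]) (auto intro!: always_eventually continuous_intros)
qed

lemma has_derivative_cas_series:
  fixes z :: "nat \<Rightarrow> real^2"
  assumes k: "summable (\<lambda>n. \<bar>k n\<bar>)" and kz: "summable (\<lambda>n. \<bar>k n\<bar> * norm (z n))"
  shows "((\<lambda>x. \<Sum>n. k n * cas (z n \<bullet> x)) has_derivative
    (\<lambda>h. \<Sum>n. k n * (z n \<bullet> h) * cas ((- z n) \<bullet> x))) (at x)"
proof -
  define f' where "f' n x h = k n * (z n \<bullet> h) * cas ((- z n) \<bullet> x)" for n x h
  have b: "\<bar>f' n x h\<bar> \<le> 2 * (\<bar>k n\<bar> * norm (z n)) * norm h" for n x h
  proof -
    have "\<bar>f' n x h\<bar> = \<bar>k n\<bar> * \<bar>z n \<bullet> h\<bar> * \<bar>cas ((- z n) \<bullet> x)\<bar>"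
      by (simp add: f'_def abs_mult)
    also have "\<dots> \<le> \<bar>k n\<bar> * (norm (z n) * norm h) * 2"
      by (intro mult_mono Cauchy_Schwarz_ineq2 abs_cas_le) auto
    finally show ?thesis by (simp add: mult_ac)
  qed
  have s: "summable (\<lambda>n. 2 * (\<bar>k n\<bar> * norm (z n)))" using kz by (rule summable_mult)
  then have sh: "summable (\<lambda>n. 2 * (\<bar>k n\<bar> * norm (z n)) * norm h)" for h :: "real^2"
    by (rule summable_mult2)
  have sa: "summable (\<lambda>n. \<bar>f' n x h\<bar>)" for x h
    by (rule summable_comparison_test'[OF sh[of h]]) (use b in auto)
  have sf: "summable (\<lambda>n. f' n x h)" for x h using sa by (rule summable_rabs_cancel)
  have "\<exists>g. \<forall>x\<in>UNIV. (\<lambda>n. k n * cas (z n \<bullet> x)) sums (g x) \<and>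
      (g has_derivative (\<lambda>h. \<Sum>n. f' n x h)) (at x within UNIV)"
  proof (rule has_derivative_series)
    show "((\<lambda>x. k n * cas (z n \<bullet> x)) has_derivative f' n x) (at x within UNIV)" for n x
      using has_derivative_cas_inner[of "k n" "z n" x] by (simp add: f'_def[abs_def])
    show "(\<lambda>n. k n * cas (z n \<bullet> 0)) sums (\<Sum>n. k n * cas (z n \<bullet> 0))"
      using summable_cas_series(2)[OF k] by (rule summable_sums)
    show "\<forall>\<^sub>F n in sequentially. \<forall>x\<in>UNIV. \<forall>h. norm (sum (\<lambda>i. f' i x h) {..<n} - (\<Sum>n. f' n x h)) \<le> e * norm h"
      if e: "0 < e" for e
    proof -
      obtain N where N: "\<And>n. N \<le> n \<Longrightarrow> norm (\<Sum>i. 2 * (\<bar>k (i + n)\<bar> * norm (z (i + n)))) < e"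
        using suminf_exist_split[OF e s] by blast
      have "norm (sum (\<lambda>i. f' i x h) {..<n} - (\<Sum>n. f' n x h)) \<le> e * norm h" if "N \<le> n" for n x h
      proof -
        have "(\<Sum>n. f' n x h) = (\<Sum>i. f' (i + n) x h) + sum (\<lambda>i. f' i x h) {..<n}"
          by (rule suminf_split_initial_segment[OF sf])
        then have "norm (sum (\<lambda>i. f' i x h) {..<n} - (\<Sum>n. f' n x h)) = \<bar>\<Sum>i. f' (i + n) x h\<bar>"
          by simp
        also have "\<dots> \<le> (\<Sum>i. \<bar>f' (i + n) x h\<bar>)"
          by (rule summable_rabs) (use sa[of x h] in \<open>rule summable_ignore_initial_segment\<close>)
        also have "\<dots> \<le> (\<Sum>i. 2 * (\<bar>k (i + n)\<bar> * norm (z (i + n))) * norm h)"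
          by (rule suminf_le[OF b summable_ignore_initial_segment[OF sa] summable_ignore_initial_segment[OF sh]])
        also have "\<dots> = (\<Sum>i. 2 * (\<bar>k (i + n)\<bar> * norm (z (i + n)))) * norm h"
          by (rule suminf_mult2[symmetric, OF summable_ignore_initial_segment[OF s]])
        also have "\<dots> \<le> e * norm h"
          using N[OF that] by (intro mult_right_mono) auto
        finally show ?thesis .
      qed
      then show ?thesis by (auto simp: eventually_sequentially)
    qed
  qed auto
  then obtain g where g: "\<And>x. (\<lambda>n. k n * cas (z n \<bullet> x)) sums (g x)"
      "\<And>x. (g has_derivative (\<lambda>h. \<Sum>n. f' n x h)) (at x)"
    by auto
  from g(1) have "(\<lambda>x. \<Sum>n. k n * cas (z n \<bullet> x)) = g" by (auto simp: sums_iff)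
  then show ?thesis using g(2) by (simp add: f'_def)
qed

lemma partial_cas_series:
  fixes z :: "nat \<Rightarrow> real^2"
  assumes "summable (\<lambda>n. \<bar>k n\<bar>)" "summable (\<lambda>n. \<bar>k n\<bar> * norm (z n))"
  shows "partial e (\<lambda>x. \<Sum>n. k n * cas (z n \<bullet> x)) = (\<lambda>x. \<Sum>n. k n * (z n \<bullet> e) * cas ((- z n) \<bullet> x))"
  by (rule ext, rule partial_eqI[OF has_derivative_cas_series[OF assms]])

text \<open>A partial derivative of a series of waves is again such a series, with coefficients
  \<open>k\<^sub>n (z\<^sub>n \<bullet> e)\<close> and wave vectors \<open>-z\<^sub>n\<close>. Hence the induction over the order, with \<open>k\<close> and \<open>z\<close>
  arbitrary.\<close>

lemma class_C_cas_series:
  fixes z :: "nat \<Rightarrow> real^2"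
  assumes "\<And>j. j \<le> m \<Longrightarrow> summable (\<lambda>n. \<bar>k n\<bar> * norm (z n) ^ j)"
  shows "class_C m (\<lambda>x. \<Sum>n. k n * cas (z n \<bullet> x))"
  using assms
proof (induction m arbitrary: k z)
  case 0
  then show ?case using 0[of 0] by (auto intro!: continuous_cas_series)
next
  case (Suc m)
  have 0: "summable (\<lambda>n. \<bar>k n\<bar>)" "summable (\<lambda>n. \<bar>k n\<bar> * norm (z n))"
    using Suc.prems[of 0] Suc.prems[of 1] by auto
  have "class_C m (\<lambda>x. \<Sum>n. k n * (z n \<bullet> e) * cas ((- z n) \<bullet> x))" if "e \<in> Basis" for e
  proof (rule Suc.IH)
    fix j assume "j \<le> m"
    then have "summable (\<lambda>n. \<bar>k n\<bar> * norm (z n) ^ Suc j)" by (intro Suc.prems) simp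
    then show "summable (\<lambda>n. \<bar>k n * (z n \<bullet> e)\<bar> * norm (- z n) ^ j)"
    proof (rule summable_comparison_test')
      fix n :: nat
      have "\<bar>z n \<bullet> e\<bar> \<le> norm (z n)" using that by (simp add: Basis_le_norm)
      then have "\<bar>k n\<bar> * \<bar>z n \<bullet> e\<bar> * norm (z n) ^ j \<le> \<bar>k n\<bar> * norm (z n) * norm (z n) ^ j"
        by (intro mult_mono) auto
      then show "norm (\<bar>k n * (z n \<bullet> e)\<bar> * norm (- z n) ^ j) \<le> \<bar>k n\<bar> * norm (z n) ^ Suc j"
        by (simp add: abs_mult mult_ac)
    qed
  qed
  moreover have "(\<lambda>x. \<Sum>n. k n * cas (z n \<bullet> x)) differentiable (at x)" for x
    using has_derivative_cas_series[OF 0] differentiable_def by blast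
  ultimately show ?case by (simp only: class_C.simps partial_cas_series[OF 0]) simp
qed

lemma laplacian_cas_series:
  fixes z :: "nat \<Rightarrow> real^2"
  assumes "\<And>j. j \<le> 2 \<Longrightarrow> summable (\<lambda>n. \<bar>k n\<bar> * norm (z n) ^ j)"
  shows "laplacian (\<lambda>x. \<Sum>n. k n * cas (z n \<bullet> x)) x = (\<Sum>n. - (k n * (norm (z n))\<^sup>2 * cas (z n \<bullet> x)))"
proof -
  have 0: "summable (\<lambda>n. \<bar>k n\<bar>)" "summable (\<lambda>n. \<bar>k n\<bar> * norm (z n))" and 2: "summable (\<lambda>n. \<bar>k n\<bar> * (norm (z n))\<^sup>2)"
    using assms[of 0] assms[of 1] assms[of 2] by auto
  have le: "\<bar>z n \<bullet> e\<bar> \<le> norm (z n)" if "e \<in> Basis" for e n using that by (simp add: Basis_le_norm)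
  have 1: "summable (\<lambda>n. \<bar>k n * (z n \<bullet> e)\<bar>)" "summable (\<lambda>n. \<bar>k n * (z n \<bullet> e)\<bar> * norm (- z n))"
      "summable (\<lambda>n. \<bar>k n * (z n \<bullet> e) * ((- z n) \<bullet> e)\<bar>)"
    if e: "e \<in> Basis" for e
  proof -
    show "summable (\<lambda>n. \<bar>k n * (z n \<bullet> e)\<bar>)"
      by (rule summable_comparison_test'[OF 0(2)])
        (use le[OF e] in \<open>auto simp: abs_mult intro!: mult_left_mono\<close>)
    have "\<bar>k n\<bar> * \<bar>z n \<bullet> e\<bar> * norm (z n) \<le> \<bar>k n\<bar> * norm (z n) * norm (z n)" for n
      using le[OF e] by (intro mult_mono) auto
    then show "summable (\<lambda>n. \<bar>k n * (z n \<bullet> e)\<bar> * norm (- z n))"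
      by (intro summable_comparison_test'[OF 2]) (simp add: abs_mult power2_eq_square mult_ac)
    have "\<bar>k n\<bar> * \<bar>z n \<bullet> e\<bar> * \<bar>z n \<bullet> e\<bar> \<le> \<bar>k n\<bar> * norm (z n) * norm (z n)" for n
      using le[OF e] by (intro mult_mono) auto
    then show "summable (\<lambda>n. \<bar>k n * (z n \<bullet> e) * ((- z n) \<bullet> e)\<bar>)"
      by (intro summable_comparison_test'[OF 2]) (simp add: abs_mult power2_eq_square mult_ac)
  qed
  have "partial e (partial e (\<lambda>x. \<Sum>n. k n * cas (z n \<bullet> x))) x
      = (\<Sum>n. k n * (z n \<bullet> e) * ((- z n) \<bullet> e) * cas (z n \<bullet> x))" if "e \<in> Basis" for e
    using partial_cas_series[OF 1(1,2)[OF that], of e] by (simp add: partial_cas_series[OF 0])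
  then have "laplacian (\<lambda>x. \<Sum>n. k n * cas (z n \<bullet> x)) x
      = (\<Sum>e\<in>Basis. \<Sum>n. k n * (z n \<bullet> e) * ((- z n) \<bullet> e) * cas (z n \<bullet> x))"
    by (simp add: laplacian_def)
  also have "\<dots> = (\<Sum>n. \<Sum>e\<in>Basis. k n * (z n \<bullet> e) * ((- z n) \<bullet> e) * cas (z n \<bullet> x))"
    by (rule suminf_sum[symmetric]) (rule summable_cas_series(2)[OF 1(3)])
  also have "(\<lambda>n. \<Sum>e\<in>Basis. k n * (z n \<bullet> e) * ((- z n) \<bullet> e) * cas (z n \<bullet> x))
      = (\<lambda>n. - (k n * (norm (z n))\<^sup>2 * cas (z n \<bullet> x)))"
    by (simp add: power2_norm_eq_inner euclidean_inner[of "z _" "z _"] sum_distrib_right sum_distrib_left sum_negf mult_ac)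
  finally show ?thesis .
qed

lemma cell_integral_cas_series:
  assumes P: "invertible P" and k: "summable (\<lambda>n. \<bar>k n\<bar>)"
  shows "cell_integral P (\<lambda>x. (\<Sum>n. k n * cas (z n \<bullet> x)) * cas (y \<bullet> x))
     = (\<Sum>n. k n * cell_integral P (\<lambda>x. cas (z n \<bullet> x) * cas (y \<bullet> x)))"
proof -
  define f where "f n x = indicator (cell P) x * (k n * (cas (z n \<bullet> x) * cas (y \<bullet> x)))" for n x
  have int: "integrable lborel (f n)" for n
    using set_integrable_cell[OF P, of "\<lambda>x. k n * (cas (z n \<bullet> x) * cas (y \<bullet> x))"]
    by (simp add: f_def[abs_def] set_integrable_def continuous_on_mult)
  have cc: "\<bar>cas s * cas t\<bar> \<le> 4" for s t
    using mult_mono[OF abs_cas_le[of s] abs_cas_le[of t]] by (simp add: abs_mult)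
  have b: "\<bar>k n * (cas (z n \<bullet> x) * cas (y \<bullet> x))\<bar> \<le> 4 * \<bar>k n\<bar>" for n x
    using mult_left_mono[OF cc[of "z n \<bullet> x" "y \<bullet> x"], of "\<bar>k n\<bar>"] by (simp add: abs_mult mult_ac)
  have s4: "summable (\<lambda>n. 4 * \<bar>k n\<bar>)" using k by (rule summable_mult)
  have "(LINT x|lborel. (\<Sum>n. f n x)) = (\<Sum>n. LINT x|lborel. f n x)"
  proof (rule integral_suminf[OF int])
    have "norm (norm (f n x)) \<le> 4 * \<bar>k n\<bar>" for n x
      using b[of n x] by (cases "x \<in> cell P") (simp_all add: f_def)
    then show "AE x in lborel. summable (\<lambda>n. norm (f n x))"
      by (intro AE_I2 summable_comparison_test'[OF s4])
    show "summable (\<lambda>n. LINT x|lborel. norm (f n x))"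
    proof (rule summable_comparison_test')
      show "summable (\<lambda>n. (4 * \<bar>k n\<bar>) * cell_area P)" using s4 by (rule summable_mult2)
      fix n :: nat
      have "(LINT x|lborel. norm (f n x)) = cell_integral P (\<lambda>x. \<bar>k n * (cas (z n \<bullet> x) * cas (y \<bullet> x))\<bar>)"
      proof -
        have "norm (f n x) = indicator (cell P) x *\<^sub>R \<bar>k n * (cas (z n \<bullet> x) * cas (y \<bullet> x))\<bar>" for x
          by (cases "x \<in> cell P") (simp_all add: f_def)
        then show ?thesis by (simp only: cell_integral_def set_lebesgue_integral_def)
      qed
      also have "\<dots> \<le> cell_integral P (\<lambda>x. 4 * \<bar>k n\<bar>)"
        by (intro cell_integral_mono P b continuous_intros)
      finally show "norm (LINT x|lborel. norm (f n x)) \<le> (4 * \<bar>k n\<bar>) * cell_area P"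
        by (subst real_norm_def, subst abs_of_nonneg) auto
    qed
  qed
  moreover have "(\<Sum>n. f n x) = indicat_real (cell P) x *\<^sub>R ((\<Sum>n. k n * cas (z n \<bullet> x)) * cas (y \<bullet> x))" for x
  proof -
    have "(\<Sum>n. k n * cas (z n \<bullet> x)) * cas (y \<bullet> x) = (\<Sum>n. k n * cas (z n \<bullet> x) * cas (y \<bullet> x))"
      by (rule suminf_mult2[OF summable_cas_series(2)[OF k]])
    then show ?thesis by (cases "x \<in> cell P") (simp_all add: f_def mult.assoc)
  qed
  moreover have "(LINT x|lborel. f n x) = k n * cell_integral P (\<lambda>x. cas (z n \<bullet> x) * cas (y \<bullet> x))" for n
    unfolding cell_integral_cmult[symmetric] unfolding f_def cell_integral_def set_lebesgue_integral_def real_scaleR_def ..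
  ultimately show ?thesis by (simp add: cell_integral_def set_lebesgue_integral_def)
qed

section \<open>Completeness of the plane waves\<close>

text \<open>Periodic functions do not separate the points of a closed cell. They are therefore regarded
  as functions on the torus, embedded in \<open>\<complex>\<^sup>2\<close>, where the Stone--Weierstrass theorem applies
  and the polynomials in the coordinates are trigonometric polynomials.\<close>

definition torus_map :: "real^2^2 \<Rightarrow> real^2 \<Rightarrow> complex \<times> complex" where
  "torus_map P x = (cis (2 * pi * lattice_coord P 1 x), cis (2 * pi * lattice_coord P 2 x))"

definition wave_null :: "real^2^2 \<Rightarrow> (real^2 \<Rightarrow> real) \<Rightarrow> bool" where
  "wave_null P g \<longleftrightarrow> (\<forall>m. cell_integral P (\<lambda>x. g x * cas (wave P m \<bullet> x)) = 0)"

lemma continuous_torus_map: "continuous_on S (torus_map P)"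
  unfolding torus_map_def[abs_def] cis_conv_exp by (intro continuous_intros)

lemma torus_map_eqD:
  assumes "torus_map P x = torus_map P y"
  shows "lattice_coord P i x - lattice_coord P i y \<in> \<int>"
proof -
  have aux: "a - b \<in> \<int>" if "cis (2 * pi * a) = cis (2 * pi * b)" for a b
  proof -
    have "cos (2 * pi * a) = cos (2 * pi * b)" "sin (2 * pi * a) = sin (2 * pi * b)"
      using that by (auto simp: complex_eq_iff)
    then have "cos (2 * pi * a - 2 * pi * b) = 1"
      using sin_cos_squared_add2[of "2 * pi * b"] by (simp add: cos_diff power2_eq_square)
    then obtain n :: int where "2 * pi * a - 2 * pi * b = of_int n * 2 * pi"
      using cos_one_2pi_int by metis
    then have "(a - b) * (2 * pi) = of_int n * (2 * pi)" by (simp add: algebra_simps)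
    then have "a - b = of_int n" by simp
    then show ?thesis by simp
  qed
  have "i = 1 \<or> i = 2" using exhaust_2 by auto
  then show ?thesis using assms aux by (auto simp: torus_map_def)
qed

lemma wave_null_add:
  assumes "invertible P" "continuous_on UNIV f" "continuous_on UNIV g" "wave_null P f" "wave_null P g"
  shows "wave_null P (\<lambda>x. f x + g x)"
  using assms by (simp add: wave_null_def distrib_right cell_integral_add continuous_on_mult)

lemma wave_null_cmult: "wave_null P f \<Longrightarrow> wave_null P (\<lambda>x. f x * c)"
  unfolding wave_null_def
  using cell_integral_cmult[of P c "\<lambda>x. f x * cas (wave P _ \<bullet> x)"] by (simp add: mult_ac)

lemma wave_null_mult_wave:
  assumes P: "invertible P" and g: "continuous_on UNIV g" "wave_null P g"
  shows "wave_null P (\<lambda>x. g x * cos (wave P l \<bullet> x))" "wave_null P (\<lambda>x. g x * sin (wave P l \<bullet> x))"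
proof -
  have half: "cell_integral P (\<lambda>x. f x / 2) = cell_integral P f / 2" for f
    using cell_integral_cmult[of P "1/2" f] by simp
  have null: "cell_integral P (\<lambda>x. g x * cas (wave P m \<bullet> x)) = 0" for m
    using g(2) unfolding wave_null_def by blast
  have c: "continuous_on UNIV (\<lambda>x. g x * cas (wave P m \<bullet> x))" for m
    using g(1) by (intro continuous_on_mult continuous_cas_inner)
  have trig: "cos b * cas a = (cas (a + b) + cas (a - b)) / 2" for a b
    unfolding cas_def by (simp add: cos_add cos_diff sin_add sin_diff algebra_simps)
  have "(\<lambda>x. g x * cos (wave P l \<bullet> x) * cas (wave P m \<bullet> x))
      = (\<lambda>x. (g x * cas (wave P (m + l) \<bullet> x) + g x * cas (wave P (m - l) \<bullet> x)) / 2)" for m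
    unfolding wave_add wave_diff inner_add_left inner_diff_left mult.assoc trig by (simp add: distrib_left)
  then show "wave_null P (\<lambda>x. g x * cos (wave P l \<bullet> x))"
    using c null by (simp add: wave_null_def half cell_integral_add[OF P])
  have trig': "sin b * cas a = (cas (- (a - b)) - cas (- (a + b))) / 2" for a b
    unfolding cas_def by (simp add: cos_add cos_diff sin_add sin_diff algebra_simps)
  have "(\<lambda>x. g x * sin (wave P l \<bullet> x) * cas (wave P m \<bullet> x))
      = (\<lambda>x. (g x * cas (wave P (-(m - l)) \<bullet> x) - g x * cas (wave P (-(m + l)) \<bullet> x)) / 2)" for m
    unfolding wave_add wave_diff wave_minus inner_add_left inner_diff_left inner_minus_left mult.assoc trig'
    by (simp add: right_diff_distrib)
  then show "wave_null P (\<lambda>x. g x * sin (wave P l \<bullet> x))"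
    using c null by (simp add: wave_null_def half cell_integral_diff[OF P])
qed

lemma continuous_real_polynomial_torus:
  assumes "real_polynomial_function p" shows "continuous_on UNIV (\<lambda>x. p (torus_map P x))"
proof -
  have "continuous_on UNIV p"
    using assms continuous_on_polymonial_function real_polynomial_function_eq by blast
  then show ?thesis by (rule continuous_on_compose2[OF _ continuous_torus_map]) simp
qed

text \<open>Orthogonality to all waves survives multiplication by a coordinate of the torus, because the
  product of a coordinate and a wave is a combination of two waves. The induction must therefore
  run over multipliers of arbitrary such \<open>g\<close>; then a product of polynomials is treated by
  multiplying with one factor after the other.\<close>

lemma wave_null_mult_polynomial:
  assumes P: "invertible P"
  shows "real_polynomial_function p \<Longrightarrow> continuous_on UNIV g \<Longrightarrow> wave_null P g \<Longrightarrow>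
    wave_null P (\<lambda>x. g x * p (torus_map P x))"
proof (induction p arbitrary: g rule: real_polynomial_function.induct)
  case (linear f)
  interpret f: bounded_linear f by fact
  define l1 l2 :: "int \<times> int" where "l1 = (1, 0)" and "l2 = (0, 1)"
  have l: "2 * pi * lattice_coord P 1 x = wave P l1 \<bullet> x" "2 * pi * lattice_coord P 2 x = wave P l2 \<bullet> x" for x
    by (simp_all add: inner_wave l1_def l2_def)
  have f_eq: "f (z, w) = Re z * f (1, 0) + Im z * f (\<i>, 0) + Re w * f (0, 1) + Im w * f (0, \<i>)" for z w
  proof -
    have "(z, w) = Re z *\<^sub>R (1, 0) + Im z *\<^sub>R (\<i>, 0) + Re w *\<^sub>R (0, 1) + Im w *\<^sub>R (0, \<i>)"
      by (simp add: complex_eq_iff)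
    from arg_cong[OF this, of f] show ?thesis
      by (simp only: f.add f.scaleR real_scaleR_def)
  qed
  have "(\<lambda>x. g x * f (torus_map P x)) = (\<lambda>x. g x * cos (wave P l1 \<bullet> x) * f (1, 0)
      + g x * sin (wave P l1 \<bullet> x) * f (\<i>, 0) + g x * cos (wave P l2 \<bullet> x) * f (0, 1) + g x * sin (wave P l2 \<bullet> x) * f (0, \<i>))"
    unfolding torus_map_def l f_eq[of "cis s" "cis t" for s t] by (simp add: distrib_left mult.assoc)
  moreover have "wave_null P \<dots>"
    using linear.prems
    by (intro wave_null_add[OF P] wave_null_cmult wave_null_mult_wave[OF P] continuous_intros)
  ultimately show ?case by simp
next
  case (const c)
  then show ?case by (simp add: wave_null_cmult)
next
  case (add p q)
  have "wave_null P (\<lambda>x. g x * p (torus_map P x) + g x * q (torus_map P x))"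
    using add by (intro wave_null_add[OF P] continuous_on_mult continuous_real_polynomial_torus) auto
  then show ?case by (simp add: distrib_left)
next
  case (mult p q)
  have "wave_null P (\<lambda>x. g x * p (torus_map P x) * q (torus_map P x))"
    using mult by (intro mult.IH(2) mult.IH(1) continuous_on_mult continuous_real_polynomial_torus) auto
  then show ?case by (simp add: mult.assoc)
qed

text \<open>All polynomials \<open>p\<close> on the torus satisfy \<open>\<integral> w p = 0\<close>, and some are uniformly close to \<open>w\<close>. So
  \<open>\<integral> w\<^sup>2 = \<integral> w (w - p)\<close> is arbitrarily small.\<close>

lemma wave_complete:
  assumes P: "invertible P" and w: "w \<in> C_per 0 P" and null: "wave_null P w"
  shows "w x = 0"
proof (rule cell_integral_square_eq_0[OF P w])
  define q where "q = torus_map P"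
  obtain K where K: "compact K" and cellK: "cell P \<subseteq> K" using cell_subset_compact by blast
  have wc: "continuous_on UNIV w" and per: "periodic P w" using w by (auto simp: C_per_def)
  have w_eq: "w x = w y" if "q x = q y" for x y
    using that torus_map_eqD periodic_lattice_coord_eq[OF P per] unfolding q_def by blast
  define V where "V z = w (SOME x. q x = z)" for z
  have V: "V (q x) = w x" for x
    unfolding V_def by (rule w_eq) (rule someI[of "\<lambda>y. q y = q x" x], simp)
  have qK: "\<exists>y\<in>K. q y = q x" for x
  proof -
    obtain y where y: "y \<in> cell P" "\<And>i. lattice_coord P i x - lattice_coord P i y \<in> \<int>"
      using cell_representative[OF P] by blast
    have "cis (2 * pi * a) = cis (2 * pi * b)" if ab: "a - b \<in> \<int>" for a b
    proof -
      obtain n where "a - b = of_int n" using ab by (elim Ints_cases)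
      then have "a = b + of_int n" by simp
      then have "2 * pi * a = 2 * pi * b + 2 * pi * of_int n" by (simp add: distrib_left)
      then have "cis (2 * pi * a) = cis (2 * pi * b) * cis (2 * pi * of_int n)" by (simp only: cis_mult)
      also have "cis (2 * pi * of_int n) = 1" by (rule cis_multiple_2pi) simp
      finally show ?thesis by simp
    qed
    then have "q x = q y" unfolding q_def torus_map_def using y(2) by blast
    then show ?thesis using y cellK by auto
  qed
  have qc: "continuous_on S q" for S unfolding q_def by (rule continuous_torus_map)
  have qcomp: "compact (q ` K)" using K qc by (rule compact_continuous_image[rotated])
  \<comment> \<open>\<open>q\<close> maps compact sets to closed sets, so it is a quotient map onto the torus.\<close>
  have Vc: "continuous_on (q ` K) V"
    unfolding continuous_on_closed_invariant
  proof (intro allI impI)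
    fix B :: "real set" assume B: "closed B"
    have "closed (w -` B)" using wc B by (simp add: continuous_on_closed_vimage)
    then have "compact (q ` (K \<inter> w -` B))"
      using K qc by (intro compact_continuous_image compact_Int_closed)
    moreover have "q ` (K \<inter> w -` B) \<inter> q ` K = V -` B \<inter> q ` K"
      using V by auto
    ultimately show "\<exists>A. closed A \<and> A \<inter> q ` K = V -` B \<inter> q ` K"
      using compact_imp_closed by blast
  qed
  define M where "M = cell_integral P (\<lambda>x. \<bar>w x\<bar>)"
  have M: "0 \<le> M" unfolding M_def by (rule cell_integral_nonneg) simp
  have le: "cell_integral P (\<lambda>x. w x * w x) \<le> e * M" if e: "0 < e" for e
  proof -
    obtain p where p: "real_polynomial_function p" "\<And>z. z \<in> q ` K \<Longrightarrow> \<bar>V z - p z\<bar> < e"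
      using Stone_Weierstrass_real_polynomial_function[OF qcomp Vc e] by blast
    have app: "\<bar>w x - p (q x)\<bar> \<le> e" for x
      using p(2)[of "q x"] qK[of x] V[of x] by (metis image_eqI less_imp_le)
    have pc: "continuous_on UNIV (\<lambda>x. p (q x))"
      unfolding q_def using p(1) by (rule continuous_real_polynomial_torus)
    have "wave_null P (\<lambda>x. w x * p (q x))"
      unfolding q_def by (rule wave_null_mult_polynomial[OF P p(1) wc null])
    then have "cell_integral P (\<lambda>x. w x * p (q x) * cas (wave P 0 \<bullet> x)) = 0"
      unfolding wave_null_def by blast
    then have 0: "cell_integral P (\<lambda>x. w x * p (q x)) = 0" by (simp add: cas_def)
    have "w x * (w x - p (q x)) \<le> e * \<bar>w x\<bar>" for x
    proof -
      have "w x * (w x - p (q x)) \<le> \<bar>w x\<bar> * \<bar>w x - p (q x)\<bar>" by (metis abs_ge_self abs_mult)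
      also have "\<dots> \<le> \<bar>w x\<bar> * e" using app by (intro mult_left_mono) auto
      finally show ?thesis by (simp add: mult.commute)
    qed
    then have "cell_integral P (\<lambda>x. w x * (w x - p (q x))) \<le> cell_integral P (\<lambda>x. e * \<bar>w x\<bar>)"
      using wc pc by (intro cell_integral_mono P continuous_intros)
    moreover have "cell_integral P (\<lambda>x. w x * (w x - p (q x))) = cell_integral P (\<lambda>x. w x * w x) - cell_integral P (\<lambda>x. w x * p (q x))"
      using wc pc by (simp add: right_diff_distrib cell_integral_diff[OF P] continuous_on_mult)
    ultimately show ?thesis using 0 by (simp add: M_def)
  qed
  have "cell_integral P (\<lambda>x. w x * w x) \<le> 0"
  proof (rule field_le_epsilon)
    fix e :: real assume "0 < e"
    then have "cell_integral P (\<lambda>x. w x * w x) \<le> e / (M + 1) * M" using M by (intro le) auto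
    also have "\<dots> \<le> e" using M \<open>0 < e\<close> by (simp add: field_simps)
    finally show "cell_integral P (\<lambda>x. w x * w x) \<le> 0 + e" by simp
  qed
  moreover have "0 \<le> cell_integral P (\<lambda>x. w x * w x)" by (rule cell_integral_nonneg) simp
  ultimately show "cell_integral P (\<lambda>x. w x * w x) = 0" by simp
qed

section \<open>The periodic Poisson problem\<close>

definition wave_index :: "nat \<Rightarrow> int \<times> int" where
  "wave_index n = (int_decode (fst (prod_decode n)), int_decode (snd (prod_decode n)))"

lemma inj_wave_index: "inj wave_index"
proof (rule injI)
  fix m n assume "wave_index m = wave_index n"
  then have "fst (prod_decode m) = fst (prod_decode n)" "snd (prod_decode m) = snd (prod_decode n)"
    by (auto simp: wave_index_def int_decode_eq)
  then have "prod_decode m = prod_decode n" by (rule prod_eqI)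
  then show "m = n" by simp
qed

lemma surj_wave_index: "\<exists>n. wave_index n = m"
proof
  show "wave_index (prod_encode (int_encode (fst m), int_encode (snd m))) = m"
    by (simp add: wave_index_def)
qed

lemma abs_int_decode_ge: "real n / 2 \<le> \<bar>real_of_int (int_decode n)\<bar>"
proof (cases "even n")
  case True
  then obtain k where k: "n = 2 * k" by (elim evenE)
  then show ?thesis by (simp add: int_decode_def sum_decode_def)
next
  case False
  then obtain k where k: "n = 2 * k + 1" by (elim oddE)
  then have "int_decode n = - int k - 1" by (simp add: int_decode_def sum_decode_def)
  then show ?thesis by (simp add: k)
qed

text \<open>The inner product of \<open>\<xi>\<^sub>m\<close> with the \<open>i\<close>-th period is \<open>2\<pi>m\<^sub>i\<close>, so the Cauchy--Schwarz inequality
  bounds the index by the wave vector.\<close>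

lemma wave_norm_ge:
  assumes P: "invertible P"
  obtains C where "0 < C" "\<And>m. (real_of_int (fst m))\<^sup>2 + (real_of_int (snd m))\<^sup>2 \<le> C * (norm (wave P m))\<^sup>2"
proof
  let ?c = "\<lambda>i. (norm (column i P))\<^sup>2"
  show "0 < 1 + ?c 1 + ?c 2" by (simp add: add_pos_nonneg)
  fix m :: "int \<times> int"
  have le: "a\<^sup>2 \<le> (norm (wave P m))\<^sup>2 * ?c i" if "wave P m \<bullet> column i P = 2 * pi * a" for a i
  proof -
    have "\<bar>a\<bar> \<le> 2 * pi * \<bar>a\<bar>" using mult_right_mono[of 1 "2 * pi" "\<bar>a\<bar>"] pi_gt3 by simp
    also have "\<dots> = \<bar>wave P m \<bullet> column i P\<bar>" using that by (simp add: abs_mult)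
    also have "\<dots> \<le> norm (wave P m) * norm (column i P)" by (rule Cauchy_Schwarz_ineq2)
    finally have "\<bar>a\<bar>\<^sup>2 \<le> (norm (wave P m) * norm (column i P))\<^sup>2" by (rule power_mono) simp
    then show ?thesis by (simp add: power_mult_distrib)
  qed
  have "(real_of_int (fst m))\<^sup>2 \<le> (norm (wave P m))\<^sup>2 * ?c 1" "(real_of_int (snd m))\<^sup>2 \<le> (norm (wave P m))\<^sup>2 * ?c 2"
    by (rule le, simp add: inner_wave lattice_coord_column[OF P])+
  then show "(real_of_int (fst m))\<^sup>2 + (real_of_int (snd m))\<^sup>2 \<le> (1 + ?c 1 + ?c 2) * (norm (wave P m))\<^sup>2"
    by (simp add: algebra_simps) (smt (verit) zero_le_power2)
qed

text \<open>The product \<open>(1 + a\<^sup>2)(1 + b\<^sup>2)\<close> is at most \<open>3 (a\<^sup>2 + b\<^sup>2)\<^sup>2\<close> for integers that are not both zero,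
  which reduces the double series to the square of a single one. The zero wave vector
  contributes \<open>1 / 0 = 0\<close>.\<close>

lemma summable_inverse_wave_norm:
  assumes P: "invertible P"
  shows "summable (\<lambda>n. 1 / (norm (wave P (wave_index n))) ^ 4)"
proof -
  obtain C where C: "0 < C" "\<And>m. (real_of_int (fst m))\<^sup>2 + (real_of_int (snd m))\<^sup>2 \<le> C * (norm (wave P m))\<^sup>2"
    using wave_norm_ge[OF P] by blast
  define h where "h n = 1 / (1 + (real_of_int (int_decode n))\<^sup>2)" for n
  have h0: "0 \<le> h n" for n by (simp add: h_def)
  have hs: "summable h"
  proof (rule summable_comparison_test')
    have "summable (\<lambda>n. 1 / real n ^ 2)" using inverse_power_summable[of 2, where 'a=real] by (simp add: inverse_eq_divide)
    then show "summable (\<lambda>n. 4 * (1 / real n ^ 2))" by (rule summable_mult)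
    fix n :: nat assume n: "1 \<le> n"
    have "(real n / 2)\<^sup>2 \<le> \<bar>real_of_int (int_decode n)\<bar>\<^sup>2" by (intro power_mono abs_int_decode_ge) simp
    then have "(real n)\<^sup>2 / 4 \<le> 1 + (real_of_int (int_decode n))\<^sup>2" by (simp add: power_divide)
    then have "h n \<le> 1 / ((real n)\<^sup>2 / 4)" unfolding h_def using n by (intro divide_left_mono mult_pos_pos) (auto intro: add_pos_nonneg)
    then show "norm (h n) \<le> 4 * (1 / real n ^ 2)" using h0[of n] by simp
  qed
  define g where "g n = h (fst (prod_decode n)) * h (snd (prod_decode n))" for n
  have gs: "summable g"
  proof (rule summableI_nonneg_bounded)
    show "0 \<le> g n" for n by (simp add: g_def h0)
    fix n
    define F where "F = prod_decode ` {..<n}"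
    define M where "M = Suc (Max (fst ` F \<union> snd ` F \<union> {0}))"
    have fin: "finite (fst ` F \<union> snd ` F \<union> {0})" by (simp add: F_def)
    have sub: "F \<subseteq> {..<M} \<times> {..<M}"
    proof
      fix p assume "p \<in> F"
      then have "fst p \<le> Max (fst ` F \<union> snd ` F \<union> {0})" "snd p \<le> Max (fst ` F \<union> snd ` F \<union> {0})"
        using fin by (auto intro!: Max_ge)
      then show "p \<in> {..<M} \<times> {..<M}" by (auto simp: M_def mem_Times_iff)
    qed
    have "sum g {..<n} = (\<Sum>p\<in>F. h (fst p) * h (snd p))"
      unfolding F_def g_def by (subst sum.reindex) (auto simp: inj_on_def)
    also have "\<dots> \<le> (\<Sum>p\<in>{..<M} \<times> {..<M}. h (fst p) * h (snd p))"
      by (rule sum_mono2) (use sub h0 in auto)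
    also have "\<dots> = sum h {..<M} * sum h {..<M}"
      by (simp add: sum_product sum.cartesian_product case_prod_beta)
    also have "\<dots> \<le> suminf h * suminf h"
      by (intro mult_mono sum_le_suminf hs sum_nonneg suminf_nonneg) (use h0 in auto)
    finally show "sum g {..<n} \<le> suminf h * suminf h" .
  qed
  show ?thesis
  proof (rule summable_comparison_test')
    show "summable (\<lambda>n. 3 * C\<^sup>2 * g n)" using gs by (rule summable_mult)
    fix n :: nat
    define a b where "a = fst (wave_index n)" and "b = snd (wave_index n)"
    define s where "s = (real_of_int a)\<^sup>2 + (real_of_int b)\<^sup>2"
    define r where "r = norm (wave P (wave_index n))"
    have g: "g n = 1 / ((1 + (real_of_int a)\<^sup>2) * (1 + (real_of_int b)\<^sup>2))"
      by (simp add: g_def h_def a_def b_def wave_index_def)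
    show "norm (1 / norm (wave P (wave_index n)) ^ 4) \<le> 3 * C\<^sup>2 * g n"
    proof (cases "wave_index n = 0")
      case True
      then show ?thesis using g by simp
    next
      case False
      then have "a \<noteq> 0 \<or> b \<noteq> 0" by (auto simp: a_def b_def prod_eq_iff)
      then have "1 \<le> a\<^sup>2 + b\<^sup>2" by (smt (verit) zero_le_power2 zero_less_power2)
      then have s1: "1 \<le> s" unfolding s_def using of_int_le_iff[of 1 "a\<^sup>2 + b\<^sup>2", where 'a=real] by simp
      have sC: "s \<le> C * r\<^sup>2" using C(2)[of "wave_index n"] by (simp add: s_def a_def b_def r_def)
      have "(1 + (real_of_int a)\<^sup>2) * (1 + (real_of_int b)\<^sup>2) \<le> 1 + s + s\<^sup>2"
      proof -
        have "(real_of_int a)\<^sup>2 * (real_of_int b)\<^sup>2 \<le> s * s"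
          unfolding s_def by (intro mult_mono) auto
        then show ?thesis by (simp add: s_def algebra_simps power2_eq_square)
      qed
      also have "\<dots> \<le> 3 * s\<^sup>2" using s1 mult_left_mono[of 1 s s] unfolding power2_eq_square by linarith
      also have "\<dots> \<le> 3 * (C * r\<^sup>2)\<^sup>2" using sC s1 by (intro mult_left_mono power_mono) auto
      finally have le: "(1 + (real_of_int a)\<^sup>2) * (1 + (real_of_int b)\<^sup>2) \<le> 3 * C\<^sup>2 * r ^ 4"
        by (simp add: power_mult_distrib flip: power_mult)
      have "0 < r" using False by (simp add: r_def wave_eq_0_iff[OF P])
      have "0 < (1 + (real_of_int a)\<^sup>2) * (1 + (real_of_int b)\<^sup>2)" by (intro mult_pos_pos add_pos_nonneg) auto
      with le \<open>0 < r\<close> have "1 / r ^ 4 \<le> 3 * C\<^sup>2 / ((1 + (real_of_int a)\<^sup>2) * (1 + (real_of_int b)\<^sup>2))"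
        by (simp add: divide_simps)
      then show ?thesis using \<open>0 < r\<close> by (simp add: g r_def)
    qed
  qed
qed

lemma suminf_single:
  fixes f :: "nat \<Rightarrow> real"
  assumes "\<And>n. n \<noteq> i \<Longrightarrow> f n = 0" shows "suminf f = f i"
  using suminf_finite[of "{i}" f] assms by simp

text \<open>The solution is \<open>u = |\<Omega>|\<^sup>-\<^sup>1 \<Sum>\<^sub>m |\<xi>\<^sub>m|\<^sup>-\<^sup>2 c\<^sub>m cas (\<xi>\<^sub>m \<bullet> x)\<close> with the wave coefficients \<open>c\<^sub>m\<close> of \<open>v\<close>. It
  is twice continuously differentiable as soon as \<open>\<Sum>\<^sub>m |c\<^sub>m|\<close> converges. That is where \<open>v \<in> C\<^sup>2\<close> and
  the dimension two enter: \<open>c\<^sub>m = - |\<xi>\<^sub>m|\<^sup>-\<^sup>2 d\<^sub>m\<close> with the coefficients \<open>d\<^sub>m\<close> of \<open>\<Delta>v\<close>, and both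
  \<open>|\<xi>\<^sub>m|\<^sup>-\<^sup>4\<close> and \<open>d\<^sub>m\<^sup>2\<close> are summable, the latter by Bessel's inequality. The series \<open>-\<Delta>u\<close> has the
  same coefficients as \<open>v\<close>, and completeness gives \<open>-\<Delta>u = v\<close>.\<close>

theorem poisson_solvable:
  assumes P: "invertible P" and v: "v \<in> C_per 2 P" and mean: "cell_integral P v = 0"
  obtains u where "u \<in> C_per 2 P" "cell_integral P u = 0" "\<And>x. - laplacian u x = v x"
proof
  define V where "V = cell_area P"
  have V: "0 < V" using P by (simp add: V_def cell_area_pos)
  define z where "z n = wave P (wave_index n)" for n
  define c where "c n = cell_integral P (\<lambda>x. v x * cas (z n \<bullet> x))" for n
  define d where "d n = cell_integral P (\<lambda>x. laplacian v x * cas (z n \<bullet> x))" for n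
  \<comment> \<open>At the zero wave vector the quotient is \<open>0\<close> by convention, and \<open>c\<close> vanishes there too.\<close>
  define k where "k n = c n / (V * (norm (z n))\<^sup>2)" for n
  define u where "u x = (\<Sum>n. k n * cas (z n \<bullet> x))" for x
  have z0: "z n = 0 \<longleftrightarrow> wave_index n = 0" for n by (simp add: z_def wave_eq_0_iff[OF P])
  have c0: "c n = 0" if "z n = 0" for n using that mean by (simp add: c_def cas_def)
  have vc: "continuous_on UNIV v" using v by (rule C_per_continuous)
  have lvc: "continuous_on UNIV (laplacian v)"
    using v C_per_laplacian[of v 0 P] C_per_continuous by (simp add: numeral_2_eq_2)
  have d: "d n = - (norm (z n))\<^sup>2 * c n" for n
  proof -
    have "d n = cell_integral P (\<lambda>x. v x * laplacian (\<lambda>x. cas (z n \<bullet> x)) x)"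
      unfolding d_def z_def by (rule green_second[OF P v cas_wave_C_per[OF P], symmetric])
    also have "\<dots> = cell_integral P (\<lambda>x. - (norm (z n))\<^sup>2 * (v x * cas (z n \<bullet> x)))"
      unfolding laplacian_cas by (simp add: mult_ac)
    also have "\<dots> = - (norm (z n))\<^sup>2 * c n"
      unfolding cell_integral_cmult c_def ..
    finally show ?thesis .
  qed
  have dsum: "summable (\<lambda>n. (d n)\<^sup>2)"
  proof (rule summableI_nonneg_bounded)
    fix n
    have inj: "inj_on wave_index {..<n}" using inj_wave_index by (rule inj_on_subset) simp
    have "(\<Sum>i<n. (d i)\<^sup>2) = (\<Sum>m\<in>wave_index ` {..<n}. (cell_integral P (\<lambda>x. laplacian v x * cas (wave P m \<bullet> x)))\<^sup>2)"
      by (simp add: sum.reindex[OF inj] d_def z_def)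
    also have "\<dots> \<le> cell_area P * cell_integral P (\<lambda>x. laplacian v x * laplacian v x)"
      by (intro bessel_wave P lvc) simp
    finally show "(\<Sum>i<n. (d i)\<^sup>2) \<le> cell_area P * cell_integral P (\<lambda>x. laplacian v x * laplacian v x)" .
  qed simp
  have csum: "summable (\<lambda>n. \<bar>c n\<bar>)"
  proof (rule summable_comparison_test')
    show "summable (\<lambda>n. 1 / norm (z n) ^ 4 + (d n)\<^sup>2)"
      unfolding z_def using summable_inverse_wave_norm[OF P] dsum by (rule summable_add)
    fix n :: nat
    show "norm \<bar>c n\<bar> \<le> 1 / norm (z n) ^ 4 + (d n)\<^sup>2"
    proof (cases "z n = 0")
      case False
      define r where "r = 1 / (norm (z n))\<^sup>2"
      have "c n = - (r * d n)" using False by (simp add: d r_def)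
      then have "\<bar>c n\<bar> = \<bar>r\<bar> * \<bar>d n\<bar>" by (simp add: abs_mult)
      moreover have "2 * (\<bar>r\<bar> * \<bar>d n\<bar>) \<le> r\<^sup>2 + (d n)\<^sup>2"
        using sum_squares_bound[of "\<bar>r\<bar>" "\<bar>d n\<bar>"] by simp
      moreover have "0 \<le> \<bar>r\<bar> * \<bar>d n\<bar>" by simp
      ultimately have "\<bar>c n\<bar> \<le> r\<^sup>2 + (d n)\<^sup>2" by linarith
      then show ?thesis by (simp add: r_def power_divide flip: power_mult)
    qed (simp add: c0)
  qed
  obtain C where C: "0 < C" "\<And>m. (real_of_int (fst m))\<^sup>2 + (real_of_int (snd m))\<^sup>2 \<le> C * (norm (wave P m))\<^sup>2"
    using wave_norm_ge[OF P] by blast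
  have low: "1 \<le> C * (norm (z n))\<^sup>2" if "z n \<noteq> 0" for n
  proof -
    have "fst (wave_index n) \<noteq> 0 \<or> snd (wave_index n) \<noteq> 0" using that z0 by (auto simp: prod_eq_iff)
    then have "1 \<le> (fst (wave_index n))\<^sup>2 + (snd (wave_index n))\<^sup>2" by (smt (verit) zero_le_power2 zero_less_power2)
    then have "1 \<le> (real_of_int (fst (wave_index n)))\<^sup>2 + (real_of_int (snd (wave_index n)))\<^sup>2"
      using of_int_le_iff[of 1 "(fst (wave_index n))\<^sup>2 + (snd (wave_index n))\<^sup>2", where 'a=real] by simp
    with C(2)[of "wave_index n"] show ?thesis by (simp add: z_def)
  qed
  have k2: "\<bar>k n\<bar> * (norm (z n))\<^sup>2 = \<bar>c n\<bar> / V" for n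
    using V by (cases "z n = 0") (simp_all add: k_def c0 abs_mult)
  have k0: "\<bar>k n\<bar> \<le> C * (\<bar>c n\<bar> / V)" for n
  proof (cases "z n = 0")
    case False
    have "\<bar>k n\<bar> * 1 \<le> \<bar>k n\<bar> * (C * (norm (z n))\<^sup>2)" using low[OF False] by (intro mult_left_mono) auto
    also have "\<dots> = C * (\<bar>k n\<bar> * (norm (z n))\<^sup>2)" by simp
    finally show ?thesis by (simp only: k2 mult_1_right)
  qed (simp add: k_def c0)
  have s2: "summable (\<lambda>n. \<bar>c n\<bar> / V)" using csum by (rule summable_divide)
  have ks: "summable (\<lambda>n. \<bar>k n\<bar> * norm (z n) ^ j)" if "j \<le> 2" for j
  proof (rule summable_comparison_test')
    show "summable (\<lambda>n. C * (\<bar>c n\<bar> / V) + \<bar>c n\<bar> / V)" using s2 by (intro summable_add summable_mult)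
    fix n :: nat
    have "norm (z n) ^ j \<le> 1 + (norm (z n))\<^sup>2"
    proof (cases "norm (z n) \<le> 1")
      case True
      then have "norm (z n) ^ j \<le> 1" by (simp add: power_le_one)
      then show ?thesis by (smt (verit) zero_le_power2)
    next
      case False
      then have "norm (z n) ^ j \<le> (norm (z n))\<^sup>2" using that by (intro power_increasing) auto
      then show ?thesis by simp
    qed
    then have "\<bar>k n\<bar> * norm (z n) ^ j \<le> \<bar>k n\<bar> * (1 + (norm (z n))\<^sup>2)" by (intro mult_left_mono) auto
    then show "norm (\<bar>k n\<bar> * norm (z n) ^ j) \<le> C * (\<bar>c n\<bar> / V) + \<bar>c n\<bar> / V"
      using k0[of n] k2[of n] by (simp add: distrib_left)
  qed
  have ksum: "summable (\<lambda>n. \<bar>k n\<bar>)" using ks[of 0] by simp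
  have "periodic P u"
    using periodic_cas_wave[OF P] by (simp add: periodic_def u_def z_def)
  moreover have "class_C 2 u" unfolding u_def[abs_def] by (rule class_C_cas_series) (rule ks)
  ultimately show "u \<in> C_per 2 P" by (simp add: C_per_def)
  have coeff: "cell_integral P (\<lambda>x. (\<Sum>n. a n * cas (z n \<bullet> x)) * cas (z i \<bullet> x)) = a i * V"
    if "summable (\<lambda>n. \<bar>a n\<bar>)" for a i
  proof -
    have "cell_integral P (\<lambda>x. (\<Sum>n. a n * cas (z n \<bullet> x)) * cas (z i \<bullet> x))
        = (\<Sum>n. a n * (if wave_index n = wave_index i then V else 0))"
      unfolding cell_integral_cas_series[OF P that] unfolding z_def cas_wave_orthogonal[OF P] V_def ..
    also have "\<dots> = a i * V"
      by (subst suminf_single[of i]) (use inj_wave_index in \<open>auto simp: inj_def\<close>)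
    finally show ?thesis .
  qed
  obtain i0 where i0: "wave_index i0 = 0" using surj_wave_index by blast
  then have "z i0 = 0" by (simp add: z0)
  then show "cell_integral P u = 0"
    using coeff[OF ksum, of i0] by (simp add: u_def[abs_def] cas_def k_def)
  define w where "w x = (\<Sum>n. c n / V * cas (z n \<bullet> x))" for x
  have cV: "summable (\<lambda>n. \<bar>c n / V\<bar>)" using s2 V by simp
  have lap: "- laplacian u x = w x" for x
  proof -
    have "k n * (norm (z n))\<^sup>2 * cas (z n \<bullet> x) = c n / V * cas (z n \<bullet> x)" for n
      using V by (cases "z n = 0") (simp_all add: k_def c0)
    then have "laplacian u x = (\<Sum>n. - (c n / V * cas (z n \<bullet> x)))"
      unfolding u_def[abs_def] by (subst laplacian_cas_series[OF ks]) simp_all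
    then show ?thesis
      using suminf_minus[OF summable_cas_series(2)[OF cV, of "\<lambda>n. z n \<bullet> x"]] by (simp add: w_def)
  qed
  have wc: "continuous_on UNIV w" unfolding w_def[abs_def] by (rule continuous_cas_series[OF cV])
  have "periodic P w"
    using periodic_cas_wave[OF P] by (simp add: periodic_def w_def z_def)
  then have "(\<lambda>x. v x - w x) \<in> C_per 0 P"
    using wc C_per_imp_0[OF v] by (intro C_per_diff) (auto simp: C_per_def)
  moreover have "wave_null P (\<lambda>x. v x - w x)"
    unfolding wave_null_def
  proof
    fix m
    obtain i where i: "wave_index i = m" using surj_wave_index by blast
    have "cell_integral P (\<lambda>x. w x * cas (z i \<bullet> x)) = c i"
      unfolding w_def coeff[OF cV] using V by simp
    then show "cell_integral P (\<lambda>x. (v x - w x) * cas (wave P m \<bullet> x)) = 0"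
      using vc wc
      by (simp add: left_diff_distrib cell_integral_diff[OF P] continuous_on_mult c_def z_def i)
  qed
  ultimately have "v x - w x = 0" for x using wave_complete[OF P] by blast
  then show "- laplacian u x = v x" for x using lap by simp
qed

section \<open>The negative-order inner product\<close>

lemma partial_zero_imp_const:
  assumes w: "w \<in> C_per 1 P" and 0: "\<And>e x. e \<in> Basis \<Longrightarrow> partial e w x = 0"
  shows "w x = w y"
proof -
  have "(w has_derivative (\<lambda>h. 0)) (at z within UNIV)" for z
    using has_derivative_partial[OF C_per_differentiable[OF w], of z] 0 by simp
  then obtain c where "\<And>z. w z = c"
    using has_derivative_zero_constant[of UNIV w] by auto
  then show ?thesis by simp
qed

lemma harmonic_mean_zero_eq_0:
  assumes P: "invertible P" and w: "w \<in> C_per 2 P" and mean: "cell_integral P w = 0"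
    and lap: "\<And>x. laplacian w x = 0"
  shows "w x = 0"
proof -
  have pw: "partial e w \<in> C_per 0 P" if "e \<in> Basis" for e
    using C_per_partial[of w 1 P e] w that C_per_imp_0 by (simp add: numeral_2_eq_2)
  have "cell_integral P (\<lambda>x. \<Sum>e\<in>Basis. partial e w x * partial e w x) = 0"
    using green_first[OF P C_per_mono[OF w] w] lap by simp
  then have "(\<Sum>e\<in>Basis. cell_integral P (\<lambda>x. partial e w x * partial e w x)) = 0"
    by (subst (asm) cell_integral_sum[OF P]) (auto intro!: continuous_on_mult C_per_continuous[OF pw])
  then have "cell_integral P (\<lambda>x. partial e w x * partial e w x) = 0" if "e \<in> Basis" for e
    using that by (subst (asm) sum_nonneg_eq_0_iff) (auto intro: cell_integral_nonneg)
  then have "partial e w x = 0" if "e \<in> Basis" for e x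
    using that cell_integral_square_eq_0[OF P pw] by blast
  then have "w = (\<lambda>_. w x)"
    using partial_zero_imp_const[OF C_per_mono[OF w]] by (auto intro!: ext)
  then have "cell_integral P w = w x * cell_area P"
    by (metis cell_integral_const)
  then show ?thesis using mean cell_area_pos[OF P] by simp
qed

definition mean_zero :: "real^2^2 \<Rightarrow> (real^2 \<Rightarrow> real) set" where
  "mean_zero P = {v \<in> C_per 2 P. cell_integral P v = 0}"

lemma inv_neg_laplacian_eqI:
  assumes P: "invertible P" and u: "u \<in> C_per 2 P" "cell_integral P u = 0" "\<And>x. - laplacian u x = v x"
  shows "inv_neg_laplacian P v = u"
  unfolding inv_neg_laplacian_def
proof (rule the_equality)
  have L: "L2_inner P f (\<lambda>_. 1) = cell_integral P f" if "f \<in> C_per 2 P" for f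
    using C_per_continuous[OF that] by (simp add: L2_inner_eq[OF P])
  show "u \<in> C_per 2 P \<and> L2_inner P u (\<lambda>_. 1) = 0 \<and> (\<forall>x. - laplacian u x = v x)"
    using u L by simp
  fix w assume w: "w \<in> C_per 2 P \<and> L2_inner P w (\<lambda>_. 1) = 0 \<and> (\<forall>x. - laplacian w x = v x)"
  have "w x - u x = 0" for x
  proof (rule harmonic_mean_zero_eq_0[OF P, of "\<lambda>x. w x - u x"])
    show "(\<lambda>x. w x - u x) \<in> C_per 2 P" using w u by (intro C_per_diff) auto
    show "cell_integral P (\<lambda>x. w x - u x) = 0"
      using w u L C_per_continuous by (subst cell_integral_diff[OF P]) auto
    have "laplacian w x = laplacian u x" for x using w u(3) by (metis neg_equal_iff_equal)
    then show "laplacian (\<lambda>x. w x - u x) x = 0" for x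
      using laplacian_diff[of w P u] w u by simp
  qed
  then show "w = u" by auto
qed

lemma
  assumes P: "invertible P" and v: "v \<in> mean_zero P"
  shows inv_neg_laplacian_C_per: "inv_neg_laplacian P v \<in> C_per 2 P"
    and inv_neg_laplacian_mean: "cell_integral P (inv_neg_laplacian P v) = 0"
    and laplacian_inv_neg_laplacian: "laplacian (inv_neg_laplacian P v) x = - v x"
proof -
  obtain u where u: "u \<in> C_per 2 P" "cell_integral P u = 0" "\<And>x. - laplacian u x = v x"
    using poisson_solvable[OF P, of v] v by (auto simp: mean_zero_def)
  note eq = inv_neg_laplacian_eqI[OF P u]
  show "inv_neg_laplacian P v \<in> C_per 2 P" "cell_integral P (inv_neg_laplacian P v) = 0"
    using u by (simp_all add: eq)
  show "laplacian (inv_neg_laplacian P v) x = - v x"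
    unfolding eq using u(3)[of x] by simp
qed

lemma mean_zero_lincomb:
  assumes P: "invertible P" and v: "v \<in> mean_zero P" and w: "w \<in> mean_zero P"
  shows "(\<lambda>x. a * v x + b * w x) \<in> mean_zero P"
  using v w C_per_continuous[of v 2 P] C_per_continuous[of w 2 P]
  by (auto simp: mean_zero_def cell_integral_add[OF P] continuous_on_mult intro!: C_per_add C_per_cmult)

lemma Hm1_inner_eq:
  assumes P: "invertible P" and v: "v \<in> mean_zero P" and w: "continuous_on UNIV w"
  shows "Hm1_inner P v w = cell_integral P (\<lambda>x. inv_neg_laplacian P v x * w x)"
  unfolding Hm1_inner_def
  by (rule L2_inner_eq[OF P C_per_continuous[OF inv_neg_laplacian_C_per[OF P v]] w])

lemma Hm1_inner_commute:
  assumes P: "invertible P" and v: "v \<in> mean_zero P" and w: "w \<in> mean_zero P"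
  shows "Hm1_inner P v w = Hm1_inner P w v"
proof -
  have c: "continuous_on UNIV v" "continuous_on UNIV w"
    using v w C_per_continuous by (auto simp: mean_zero_def)
  define u where "u = inv_neg_laplacian P v"
  define y where "y = inv_neg_laplacian P w"
  have "cell_integral P (\<lambda>x. u x * laplacian y x) = cell_integral P (\<lambda>x. laplacian u x * y x)"
    unfolding u_def y_def by (rule green_second[OF P inv_neg_laplacian_C_per[OF P v] inv_neg_laplacian_C_per[OF P w]])
  then have "cell_integral P (\<lambda>x. u x * w x) = cell_integral P (\<lambda>x. v x * y x)"
    by (simp add: u_def y_def laplacian_inv_neg_laplacian[OF P v] laplacian_inv_neg_laplacian[OF P w])
  then show ?thesis
    using c by (simp add: Hm1_inner_eq[OF P v] Hm1_inner_eq[OF P w] u_def y_def mult.commute)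
qed

lemma Hm1_inner_lincomb:
  assumes P: "invertible P" and v: "v \<in> mean_zero P" "w \<in> mean_zero P" and z: "z \<in> mean_zero P"
  shows "Hm1_inner P z (\<lambda>x. a * v x + b * w x) = a * Hm1_inner P z v + b * Hm1_inner P z w"
proof -
  have c: "continuous_on UNIV v" "continuous_on UNIV w"
    using v C_per_continuous by (auto simp: mean_zero_def)
  define u where "u = inv_neg_laplacian P z"
  have uc: "continuous_on UNIV u"
    unfolding u_def by (rule C_per_continuous[OF inv_neg_laplacian_C_per[OF P z]])
  have "(\<lambda>x. u x * (a * v x + b * w x)) = (\<lambda>x. a * (u x * v x) + b * (u x * w x))"
    by (simp add: algebra_simps)
  then show ?thesis
    using c uc by (simp add: Hm1_inner_eq[OF P z] u_def[symmetric] cell_integral_add[OF P] continuous_on_mult continuous_on_add)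
qed

definition grad_inner :: "real^2^2 \<Rightarrow> (real^2 \<Rightarrow> real) \<Rightarrow> (real^2 \<Rightarrow> real) \<Rightarrow> real" where
  "grad_inner P f g = cell_integral P (\<lambda>x. \<Sum>e\<in>Basis. partial e f x * partial e g x)"

lemma grad_inner_nonneg: "0 \<le> grad_inner P f f"
  unfolding grad_inner_def by (intro cell_integral_nonneg sum_nonneg) simp

lemma Hm1_inner_self:
  assumes P: "invertible P" and v: "v \<in> mean_zero P"
  shows "Hm1_inner P v v = grad_inner P (inv_neg_laplacian P v) (inv_neg_laplacian P v)"
proof -
  let ?u = "inv_neg_laplacian P v"
  note u = inv_neg_laplacian_C_per[OF P v]
  have "cell_integral P (\<lambda>x. ?u x * laplacian ?u x) = - grad_inner P ?u ?u"
    unfolding grad_inner_def using green_first[OF P C_per_mono[OF u] u] by simp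
  moreover have "continuous_on UNIV v" using v C_per_continuous by (auto simp: mean_zero_def)
  ultimately show ?thesis
    by (simp add: Hm1_inner_eq[OF P v] laplacian_inv_neg_laplacian[OF P v])
qed

lemma Hm1_inner_self_nonneg:
  assumes "invertible P" "v \<in> mean_zero P" shows "0 \<le> Hm1_inner P v v"
  using Hm1_inner_self[OF assms] grad_inner_nonneg by simp

lemma Hm1_norm_power2:
  assumes "invertible P" "v \<in> mean_zero P" shows "(Hm1_norm P v)\<^sup>2 = Hm1_inner P v v"
  unfolding Hm1_norm_def using Hm1_inner_self_nonneg[OF assms] by simp

text \<open>On a Fourier mode with \<open>\<lambda> = |\<xi>|\<^sup>2\<close> the claim, multiplied by \<open>\<lambda>\<close>, reads
  \<open>\<lambda>\<^sup>3 - 2\<lambda>\<^sup>2 + 3/2 \<ge> 0\<close> for \<open>\<lambda> > 0\<close>. The polynomial equals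
  \<open>\<lambda> (\<lambda> - 3/2)\<^sup>2 + (\<lambda> - 9/8)\<^sup>2 + 15/64\<close>. In terms of \<open>u = (-\<Delta>)\<^sup>-\<^sup>1 v\<close>, the three summands are the
  squared norms of \<open>\<Delta>v + 3/2 v\<close> and \<open>\<nabla>(v - 9/8 u)\<close> and \<open>15/64\<close> times that of \<open>\<nabla>u\<close>, so that Green's
  formula suffices for the proof.\<close>

lemma Hm1_interpolation:
  assumes P: "invertible P" and v: "v \<in> mean_zero P"
  shows "cell_integral P (\<lambda>x. v x * v x)
    \<le> cell_integral P (\<lambda>x. one_plus_laplacian v x * one_plus_laplacian v x) + 3/2 * Hm1_inner P v v"
proof -
  define u where "u = inv_neg_laplacian P v"
  have uC: "u \<in> C_per 2 P" unfolding u_def by (rule inv_neg_laplacian_C_per[OF P v])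
  have lu: "laplacian u x = - v x" for x unfolding u_def by (rule laplacian_inv_neg_laplacian[OF P v])
  have vC: "v \<in> C_per 2 P" using v by (simp add: mean_zero_def)
  have lvC: "laplacian v \<in> C_per 0 P" using C_per_laplacian[of v 0 P] vC by (simp add: numeral_2_eq_2)
  note cont = C_per_continuous[OF uC] C_per_continuous[OF vC] C_per_continuous[OF lvC]
  let ?I = "cell_integral P"
  define y where "y x = v x - 9/8 * u x" for x
  have yC: "y \<in> C_per 2 P" unfolding y_def[abs_def] by (intro C_per_diff C_per_cmult vC uC)
  have ly: "laplacian y x = laplacian v x + 9/8 * v x" for x
    unfolding y_def[abs_def]
    by (simp only: laplacian_diff[OF vC C_per_cmult[OF uC]] laplacian_cmult[OF uC] lu)
  have uv: "Hm1_inner P v v = ?I (\<lambda>x. u x * v x)"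
    unfolding u_def by (rule Hm1_inner_eq[OF P v cont(2)])
  have gy: "0 \<le> - ?I (\<lambda>x. y x * laplacian y x)"
    using green_first[OF P C_per_mono[OF yC] yC] grad_inner_nonneg[of P y] by (simp add: grad_inner_def)
  have "?I (\<lambda>x. u x * laplacian v x) = ?I (\<lambda>x. laplacian u x * v x)"
    by (rule green_second[OF P uC vC])
  then have ulv: "?I (\<lambda>x. u x * laplacian v x) = - ?I (\<lambda>x. v x * v x)"
    by (simp add: lu)
  have "(\<lambda>x. y x * laplacian y x) = (\<lambda>x. v x * laplacian v x + 9/8 * (v x * v x)
      - 9/8 * (u x * laplacian v x) - 81/64 * (u x * v x))"
    by (auto simp: ly y_def algebra_simps)
  then have y: "?I (\<lambda>x. y x * laplacian y x) = ?I (\<lambda>x. v x * laplacian v x) + 9/8 * ?I (\<lambda>x. v x * v x)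
      - 9/8 * ?I (\<lambda>x. u x * laplacian v x) - 81/64 * ?I (\<lambda>x. u x * v x)"
    using cont by (simp only: cell_integral_add[OF P] cell_integral_diff[OF P] cell_integral_cmult
        continuous_on_mult continuous_on_add continuous_on_diff continuous_on_const)
  have "(\<lambda>x. one_plus_laplacian v x * one_plus_laplacian v x)
      = (\<lambda>x. v x * v x + 2 * (v x * laplacian v x) + laplacian v x * laplacian v x)"
    by (auto simp: one_plus_laplacian_def algebra_simps)
  then have g: "?I (\<lambda>x. one_plus_laplacian v x * one_plus_laplacian v x)
      = ?I (\<lambda>x. v x * v x) + 2 * ?I (\<lambda>x. v x * laplacian v x) + ?I (\<lambda>x. laplacian v x * laplacian v x)"
    using cont by (simp only: cell_integral_add[OF P] cell_integral_diff[OF P] cell_integral_cmult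
        continuous_on_mult continuous_on_add continuous_on_diff continuous_on_const)
  have "(\<lambda>x. (laplacian v x + 3/2 * v x) * (laplacian v x + 3/2 * v x))
      = (\<lambda>x. laplacian v x * laplacian v x + 3 * (v x * laplacian v x) + 9/4 * (v x * v x))"
    by (auto simp: algebra_simps)
  then have "?I (\<lambda>x. (laplacian v x + 3/2 * v x) * (laplacian v x + 3/2 * v x))
      = ?I (\<lambda>x. laplacian v x * laplacian v x) + 3 * ?I (\<lambda>x. v x * laplacian v x) + 9/4 * ?I (\<lambda>x. v x * v x)"
    using cont by (simp only: cell_integral_add[OF P] cell_integral_diff[OF P] cell_integral_cmult
        continuous_on_mult continuous_on_add continuous_on_diff continuous_on_const)
  moreover have "0 \<le> ?I (\<lambda>x. (laplacian v x + 3/2 * v x) * (laplacian v x + 3/2 * v x))"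
    by (rule cell_integral_nonneg) simp
  moreover have "0 \<le> Hm1_inner P v v" by (rule Hm1_inner_self_nonneg[OF P v])
  ultimately show ?thesis using gy unfolding y g uv ulv by linarith
qed

section \<open>Gradient structure of the BDF formulas\<close>

lemma bdf_gen_values:
  "bdf_gen 3 = [:11/6, -7/6, 1/3:]"
  "bdf_gen 4 = [:25/12, -23/12, 13/12, -1/4:]"
  "bdf_gen 5 = [:137/60, -163/60, 137/60, -21/20, 1/5:]"
  by (simp_all add: bdf_gen_def eval_nat_numeral one_pCons)

lemma bdf_eq:
  assumes "1 \<le> k" "k \<le> n"
  shows "bdf k \<tau> v n x = 1 / \<tau> * (\<Sum>i<k. bdf_coeff k i * backward_diff v (n - i) x)"
proof -
  have "(\<Sum>j=1..n. bdf_coeff k (n - j) * backward_diff v j x) = (\<Sum>i<n. bdf_coeff k i * backward_diff v (n - i) x)"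
    by (rule sum.reindex_bij_witness[of _ "\<lambda>i. n - i" "\<lambda>j. n - j"]) auto
  also have "\<dots> = (\<Sum>i<k. bdf_coeff k i * backward_diff v (n - i) x)"
    using assms by (intro sum.mono_neutral_right) (auto simp: bdf_coeff_eq_0)
  finally show ?thesis by (simp add: bdf_def)
qed

text \<open>The gradient structure of the BDF formulas is an identity between quadratic forms with an
  additional sum of squares, so it holds for every positive semidefinite form.\<close>

locale semi_inner =
  fixes S :: "('x \<Rightarrow> real) set" and B :: "('x \<Rightarrow> real) \<Rightarrow> ('x \<Rightarrow> real) \<Rightarrow> real"
  assumes lincomb_closed: "f \<in> S \<Longrightarrow> g \<in> S \<Longrightarrow> (\<lambda>x. a * f x + b * g x) \<in> S"
    and lincomb_right: "f \<in> S \<Longrightarrow> g \<in> S \<Longrightarrow> h \<in> S \<Longrightarrow> B h (\<lambda>x. a * f x + b * g x) = a * B h f + b * B h g"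
    and commute: "f \<in> S \<Longrightarrow> g \<in> S \<Longrightarrow> B f g = B g f"
    and nonneg: "f \<in> S \<Longrightarrow> 0 \<le> B f f"
begin

lemma lincomb5_closed:
  fixes a :: "nat \<Rightarrow> 'x \<Rightarrow> real"
  assumes "\<And>i. a i \<in> S"
  shows "(\<lambda>x. c0 * a 0 x + c1 * a 1 x + c2 * a 2 x + c3 * a 3 x + c4 * a 4 x) \<in> S"
proof -
  have a: "a 0 \<in> S" "a 1 \<in> S" "a 2 \<in> S" "a 3 \<in> S" "a 4 \<in> S" using assms by auto
  from a lincomb_closed[OF lincomb_closed[OF lincomb_closed[OF lincomb_closed[OF a(1) a(2)] a(3)] a(4)] a(5),
    of 1 1 1 c0 c1 c2 c3 c4]
  show ?thesis by simp
qed

lemma lincomb5_right: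
  fixes a :: "nat \<Rightarrow> 'x \<Rightarrow> real"
  assumes "\<And>i. a i \<in> S" and h: "h \<in> S"
  shows "B h (\<lambda>x. c0 * a 0 x + c1 * a 1 x + c2 * a 2 x + c3 * a 3 x + c4 * a 4 x)
    = c0 * B h (a 0) + c1 * B h (a 1) + c2 * B h (a 2) + c3 * B h (a 3) + c4 * B h (a 4)"
proof -
  have a: "a 0 \<in> S" "a 1 \<in> S" "a 2 \<in> S" "a 3 \<in> S" "a 4 \<in> S" using assms(1) by auto
  note 1 = lincomb_closed[OF a(1) a(2), of c0 c1]
  note 2 = lincomb_closed[OF 1 a(3), of 1 c2, simplified]
  note 3 = lincomb_closed[OF 2 a(4), of 1 c3, simplified]
  show ?thesis
    using lincomb_right[OF a(1) a(2) h, of c0 c1] lincomb_right[OF 1 a(3) h, of 1 c2]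
      lincomb_right[OF 2 a(4) h, of 1 c3] lincomb_right[OF 3 a(5) h, of 1 c4]
    by simp
qed

lemma lincomb5_self:
  fixes a :: "nat \<Rightarrow> 'x \<Rightarrow> real"
  assumes a: "\<And>i. a i \<in> S"
  shows "B (\<lambda>x. c0 * a 0 x + c1 * a 1 x + c2 * a 2 x + c3 * a 3 x + c4 * a 4 x)
           (\<lambda>x. c0 * a 0 x + c1 * a 1 x + c2 * a 2 x + c3 * a 3 x + c4 * a 4 x)
    = c0 * c0 * B (a 0) (a 0) + c1 * c1 * B (a 1) (a 1) + c2 * c2 * B (a 2) (a 2)
    + c3 * c3 * B (a 3) (a 3) + c4 * c4 * B (a 4) (a 4)
    + 2 * (c0 * c1 * B (a 0) (a 1) + c0 * c2 * B (a 0) (a 2) + c0 * c3 * B (a 0) (a 3)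
    + c0 * c4 * B (a 0) (a 4) + c1 * c2 * B (a 1) (a 2) + c1 * c3 * B (a 1) (a 3)
    + c1 * c4 * B (a 1) (a 4) + c2 * c3 * B (a 2) (a 3) + c2 * c4 * B (a 2) (a 4)
    + c3 * c4 * B (a 3) (a 4))"
proof -
  define f where "f = (\<lambda>x. c0 * a 0 x + c1 * a 1 x + c2 * a 2 x + c3 * a 3 x + c4 * a 4 x)"
  have f: "f \<in> S" unfolding f_def using a by (rule lincomb5_closed)
  have flip: "B f (a i) = c0 * B (a i) (a 0) + c1 * B (a i) (a 1) + c2 * B (a i) (a 2)
      + c3 * B (a i) (a 3) + c4 * B (a i) (a 4)" for i
    unfolding commute[OF f a] unfolding f_def by (rule lincomb5_right[of a, OF a a])
  have sym: "B (a 1) (a 0) = B (a 0) (a 1)" "B (a 2) (a 0) = B (a 0) (a 2)" "B (a 3) (a 0) = B (a 0) (a 3)"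
     "B (a 4) (a 0) = B (a 0) (a 4)" "B (a 2) (a 1) = B (a 1) (a 2)" "B (a 3) (a 1) = B (a 1) (a 3)"
     "B (a 4) (a 1) = B (a 1) (a 4)" "B (a 3) (a 2) = B (a 2) (a 3)" "B (a 4) (a 2) = B (a 2) (a 4)"
     "B (a 4) (a 3) = B (a 3) (a 4)"
    using a by (auto intro!: commute)
  have "B f (\<lambda>x. c0 * a 0 x + c1 * a 1 x + c2 * a 2 x + c3 * a 3 x + c4 * a 4 x)
      = c0 * B f (a 0) + c1 * B f (a 1) + c2 * B f (a 2) + c3 * B f (a 3) + c4 * B f (a 4)"
    by (rule lincomb5_right[of a f, OF a f])
  then have "B f f = c0 * B f (a 0) + c1 * B f (a 1) + c2 * B f (a 2) + c3 * B f (a 3) + c4 * B f (a 4)"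
    unfolding f_def .
  then show ?thesis
    unfolding f_def[symmetric] flip sym by (simp add: algebra_simps)
qed

text \<open>The difference of the two sides is a sum of squares, found by completing squares from the
  oldest value on. With \<open>a\<^sub>i = v\<^sub>n\<^sub>-\<^sub>i\<close> it is

  \<^item> \<open>1/6 (a\<^sub>0 - 7/4 a\<^sub>1 + a\<^sub>2)\<^sup>2\<close> for \<open>k = 3\<close>,
  \<^item> \<open>1/8 (- a\<^sub>0 + 3/2 a\<^sub>1 - 3/2 a\<^sub>2 + a\<^sub>3)\<^sup>2 + 1/6 (a\<^sub>0 - 29/32 a\<^sub>1 + a\<^sub>2)\<^sup>2\<close> for \<open>k = 4\<close>,
  \<^item> \<open>1/10 (a\<^sub>0 - 2 a\<^sub>1 + 2 a\<^sub>2 - 2 a\<^sub>3 + a\<^sub>4)\<^sup>2 + 1/8 (- a\<^sub>0 + 7/10 a\<^sub>1 - 7/10 a\<^sub>2 + a\<^sub>3)\<^sup>2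
      + 1/6 (a\<^sub>0 + 187/800 a\<^sub>1 + a\<^sub>2)\<^sup>2\<close> for \<open>k = 5\<close>.

  The nonnegativity of these squares is all that each case uses besides the expansion of the forms.\<close>

lemma bdf_gradient_structure:
  fixes v :: "nat \<Rightarrow> 'x \<Rightarrow> real"
  assumes k: "k \<in> {3, 4, 5}" and v: "\<And>i. i \<le> n \<Longrightarrow> v i \<in> S" and sq: "\<And>f. f \<in> S \<Longrightarrow> sq f = B f f"
  shows "G k sq v n - G k sq v (n - 1) + sigma_L k / 2 * B (v n) (v n)
    \<le> (\<Sum>i<k. bdf_coeff k i * B (v n) (v (n - i)))"
proof -
  define a where "a i = v (n - i)" for i
  have a: "a i \<in> S" for i unfolding a_def using v by simp
  define comb where "comb c0 c1 c2 c3 c4 = (\<lambda>x. c0 * a 0 x + c1 * a 1 x + c2 * a 2 x + c3 * a 3 x + c4 * a 4 x)" for c0 c1 c2 c3 c4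
  define Q where "Q c0 c1 c2 c3 c4 = B (comb c0 c1 c2 c3 c4) (comb c0 c1 c2 c3 c4)" for c0 c1 c2 c3 c4
  have comb: "comb c0 c1 c2 c3 c4 \<in> S" for c0 c1 c2 c3 c4
    unfolding comb_def by (rule lincomb5_closed[OF a])
  have Q0: "0 \<le> Q c0 c1 c2 c3 c4" for c0 c1 c2 c3 c4
    unfolding Q_def by (rule nonneg[OF comb])
  note Q = lincomb5_self[of a, OF a, folded comb_def, folded Q_def]

  have sqQ: "sq f = Q c0 c1 c2 c3 c4" if "\<And>x. f x = c0 * a 0 x + c1 * a 1 x + c2 * a 2 x + c3 * a 3 x + c4 * a 4 x"
    for f c0 c1 c2 c3 c4
  proof -
    have "f = comb c0 c1 c2 c3 c4" unfolding comb_def using that by (rule ext)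
    then show ?thesis using sq[OF comb] by (simp add: Q_def)
  qed
  have idx: "v n = a 0" "v (n - 1) = a 1" "v (n - 2) = a 2" "v (n - 3) = a 3"
      "v (n - 1 - 1) = a 2" "v (n - 1 - 2) = a 3" "v (n - 1 - 3) = a 4"
      "backward_diff v n = (\<lambda>x. a 0 x - a 1 x)" "backward_diff v (n - 1) = (\<lambda>x. a 1 x - a 2 x)"
    by (simp_all add: a_def backward_diff_def[abs_def] eval_nat_numeral)
  have sum: "(\<Sum>i<k. bdf_coeff k i * B (v n) (v (n - i))) = (\<Sum>i<k. bdf_coeff k i * B (a 0) (a i))"
    by (simp add: a_def)
  consider "k = 3" | "k = 4" | "k = 5" using k by auto
  then show ?thesis
  proof cases
    case 1
    have sqs: "sq (a 0) = Q 1 0 0 0 0"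
        "sq (\<lambda>x. 7/4 * a 0 x - a 1 x) = Q (7/4) (-1) 0 0 0"
        "sq (a 1) = Q 0 1 0 0 0"
        "sq (\<lambda>x. 7/4 * a 1 x - a 2 x) = Q 0 (7/4) (-1) 0 0"
      by (rule sqQ, simp add: field_simps)+
    have Gk: "G k sq v m = G3 sq v m" for m by (simp add: G_def 1)
    have G: "G k sq v n = 1/6 * Q 1 0 0 0 0 + 1/6 * Q (7/4) (-1) 0 0 0"
        "G k sq v (n - 1) = 1/6 * Q 0 1 0 0 0 + 1/6 * Q 0 (7/4) (-1) 0 0"
      unfolding Gk G3_def idx sqs by (rule refl)+
    have "(\<Sum>i<k. bdf_coeff k i * B (a 0) (a i)) = 11/6 * B (a 0) (a 0) - 7/6 * B (a 0) (a 1) + 1/3 * B (a 0) (a 2)"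
      unfolding 1 bdf_coeff_def bdf_gen_values by (simp add: eval_nat_numeral)
    moreover have sg: "sigma_L k = 95/48" by (simp add: sigma_L_def 1)
    ultimately show ?thesis
      using Q0[of 1 "-7/4" 1 0 0] unfolding sum unfolding G sg idx(1) Q by (simp add: field_simps)
  next
    case 2
    have sqs: "sq (a 0) = Q 1 0 0 0 0"
        "sq (\<lambda>x. 65/56 * a 0 x - a 1 x) = Q (65/56) (-1) 0 0 0"
        "sq (\<lambda>x. 3/2 * (a 0 x - a 1 x) + a 2 x) = Q (3/2) (-3/2) 1 0 0"
        "sq (a 1) = Q 0 1 0 0 0"
        "sq (\<lambda>x. 65/56 * a 1 x - a 2 x) = Q 0 (65/56) (-1) 0 0"
        "sq (\<lambda>x. 3/2 * (a 1 x - a 2 x) + a 3 x) = Q 0 (3/2) (-3/2) 1 0"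
      by (rule sqQ, simp add: field_simps)+
    have Gk: "G k sq v m = G4 sq v m" for m by (simp add: G_def 2)
    have G: "G k sq v n = 13627/43008 * Q 1 0 0 0 0 + 7/24 * Q (65/56) (-1) 0 0 0 + 1/8 * Q (3/2) (-3/2) 1 0 0"
        "G k sq v (n - 1) = 13627/43008 * Q 0 1 0 0 0 + 7/24 * Q 0 (65/56) (-1) 0 0 + 1/8 * Q 0 (3/2) (-3/2) 1 0"
      unfolding Gk G4_def idx sqs by (rule refl)+
    have "(\<Sum>i<k. bdf_coeff k i * B (a 0) (a i)) = 25/12 * B (a 0) (a 0) - 23/12 * B (a 0) (a 1)
        + 13/12 * B (a 0) (a 2) - 1/4 * B (a 0) (a 3)"
      unfolding 2 bdf_coeff_def bdf_gen_values by (simp add: eval_nat_numeral)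
    moreover have sg: "sigma_L k = 4919/3072" by (simp add: sigma_L_def 2)
    ultimately show ?thesis
      using Q0[of "-1" "3/2" "-3/2" 1 0] Q0[of 1 "-29/32" 1 0 0] unfolding sum unfolding G sg idx(1) Q by (simp add: field_simps)
  next
    case 3
    have sqs: "sq (a 0) = Q 1 0 0 0 0"
        "sq (\<lambda>x. 4931/6992 * a 0 x - a 1 x) = Q (4931/6992) (-1) 0 0 0"
        "sq (\<lambda>x. 23/18 * (a 0 x - a 1 x) + a 2 x) = Q (23/18) (-23/18) 1 0 0"
        "sq (\<lambda>x. 2 * (a 0 x - a 1 x) + 2 * a 2 x - a 3 x) = Q 2 (-2) 2 (-1) 0"
        "sq (a 1) = Q 0 1 0 0 0"
        "sq (\<lambda>x. 4931/6992 * a 1 x - a 2 x) = Q 0 (4931/6992) (-1) 0 0"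
        "sq (\<lambda>x. 23/18 * (a 1 x - a 2 x) + a 3 x) = Q 0 (23/18) (-23/18) 1 0"
        "sq (\<lambda>x. 2 * (a 1 x - a 2 x) + 2 * a 3 x - a 4 x) = Q 0 2 (-2) 2 (-1)"
      by (rule sqQ, simp add: field_simps)+
    have Gk: "G k sq v m = G5 sq v m" for m by (simp add: G_def 3)
    have G: "G k sq v n = 1198850903/1678080000 * Q 1 0 0 0 0 + 437/900 * Q (4931/6992) (-1) 0 0 0
          + 9/40 * Q (23/18) (-23/18) 1 0 0 + 1/10 * Q 2 (-2) 2 (-1) 0"
        "G k sq v (n - 1) = 1198850903/1678080000 * Q 0 1 0 0 0 + 437/900 * Q 0 (4931/6992) (-1) 0 0
          + 9/40 * Q 0 (23/18) (-23/18) 1 0 + 1/10 * Q 0 2 (-2) 2 (-1)"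
      unfolding Gk G5_def idx sqs by (rule refl)+
    have "(\<Sum>i<k. bdf_coeff k i * B (a 0) (a i)) = 137/60 * B (a 0) (a 0) - 163/60 * B (a 0) (a 1)
        + 137/60 * B (a 0) (a 2) - 21/20 * B (a 0) (a 3) + 1/5 * B (a 0) (a 4)"
      unfolding 3 bdf_coeff_def bdf_gen_values by (simp add: eval_nat_numeral)
    moreover have sg: "sigma_L k = 646631/1920000" by (simp add: sigma_L_def 3)
    ultimately show ?thesis
      using Q0[of 1 "-2" 2 "-2" 1] Q0[of "-1" "7/10" "-7/10" 1 0] Q0[of 1 "187/800" 1 0 0] unfolding sum unfolding G sg idx(1) Q by (simp add: field_simps)
  qed
qed

end

lemma semi_inner_Hm1:
  assumes P: "invertible P" shows "semi_inner (mean_zero P) (Hm1_inner P)"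
  by unfold_locales (blast intro: mean_zero_lincomb[OF P] Hm1_inner_lincomb[OF P] Hm1_inner_commute[OF P]
      Hm1_inner_self_nonneg[OF P])+

lemma G_nonneg:
  assumes "\<And>f. 0 \<le> sq f" shows "0 \<le> G k sq v n"
  using assms by (simp add: G_def G3_def G4_def G5_def)

section \<open>Energy decay and the maximum-norm bound\<close>

definition energy_density :: "real \<Rightarrow> (real^2 \<Rightarrow> real) \<Rightarrow> real^2 \<Rightarrow> real" where
  "energy_density \<epsilon> f x = 1/2 * (one_plus_laplacian f x)\<^sup>2 + 1/4 * ((f x)\<^sup>2 - \<epsilon>)\<^sup>2 - 1/4 * \<epsilon>\<^sup>2"

lemma L2_norm_power2:
  assumes P: "invertible P" and f: "continuous_on UNIV f"
  shows "(L2_norm P f)\<^sup>2 = cell_integral P (\<lambda>x. (f x)\<^sup>2)"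
proof -
  have "L2_inner P f f = cell_integral P (\<lambda>x. (f x)\<^sup>2)"
    using L2_inner_eq[OF P f f] by (simp add: power2_eq_square)
  moreover have "0 \<le> cell_integral P (\<lambda>x. (f x)\<^sup>2)" by (rule cell_integral_nonneg) simp
  ultimately show ?thesis by (simp add: L2_norm_def)
qed

lemma energy_eq:
  assumes P: "invertible P" and f: "f \<in> C_per 2 P"
  shows "energy P \<epsilon> f = cell_integral P (energy_density \<epsilon> f)"
proof -
  have gC: "one_plus_laplacian f \<in> C_per 0 P"
    using C_per_one_plus_laplacian[of f 0 P] f by (simp add: numeral_2_eq_2)
  note cont = C_per_continuous[OF gC] C_per_continuous[OF f]
  have "energy P \<epsilon> f = 1/2 * cell_integral P (\<lambda>x. (one_plus_laplacian f x)\<^sup>2)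
      + 1/4 * cell_integral P (\<lambda>x. ((f x)\<^sup>2 - \<epsilon>)\<^sup>2) - 1/4 * cell_integral P (\<lambda>x. \<epsilon>\<^sup>2)"
    unfolding energy_def using cont
    by (subst (1 2 3) L2_norm_power2[OF P]) (auto intro!: continuous_intros)
  also have "\<dots> = cell_integral P (\<lambda>x. 1/2 * (one_plus_laplacian f x)\<^sup>2 + 1/4 * ((f x)\<^sup>2 - \<epsilon>)\<^sup>2 - 1/4 * \<epsilon>\<^sup>2)"
    using cont
    by (simp only: cell_integral_add[OF P] cell_integral_diff[OF P] cell_integral_cmult
        continuous_on_mult continuous_on_add continuous_on_diff continuous_on_const continuous_on_power)
  finally show ?thesis by (simp add: energy_density_def[abs_def])
qed

text \<open>The concave part \<open>- \<epsilon>/2 a\<^sup>2\<close> of the potential, treated implicitly, costs \<open>\<epsilon>/2 (a - b)\<^sup>2\<close>; the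
  convex quartic part leaves the squares shown in the proof.\<close>

lemma double_well_difference:
  fixes a b \<epsilon> :: real
  shows "1/4 * (a\<^sup>2 - \<epsilon>)\<^sup>2 - 1/4 * (b\<^sup>2 - \<epsilon>)\<^sup>2 \<le> (a ^ 3 - \<epsilon> * a) * (a - b) + \<epsilon> / 2 * (a - b)\<^sup>2"
proof -
  have "(a ^ 3 - \<epsilon> * a) * (a - b) + \<epsilon> / 2 * (a - b)\<^sup>2 - (1/4 * (a\<^sup>2 - \<epsilon>)\<^sup>2 - 1/4 * (b\<^sup>2 - \<epsilon>)\<^sup>2)
      = 1/4 * (a\<^sup>2 - b\<^sup>2)\<^sup>2 + 1/2 * (a * (a - b))\<^sup>2"
    by (simp add: field_simps power2_eq_square power3_eq_cube)
  moreover have "0 \<le> 1/4 * (a\<^sup>2 - b\<^sup>2)\<^sup>2 + 1/2 * (a * (a - b))\<^sup>2" by simp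
  ultimately show ?thesis by linarith
qed

text \<open>The operator \<open>1 + \<Delta>\<close> is moved from the chemical potential to the increment \<open>f - g\<close>, since
  the increment is only of class \<open>C\<^sup>2\<close>. What remains is a pointwise inequality.\<close>

lemma energy_difference:
  assumes P: "invertible P" and f: "f \<in> C_per 4 P" and g: "g \<in> C_per 2 P"
  shows "energy P \<epsilon> f - energy P \<epsilon> g \<le> cell_integral P (\<lambda>x. (f x - g x) * chem_potential \<epsilon> f x)
    - 1/2 * cell_integral P (\<lambda>x. one_plus_laplacian (\<lambda>x. f x - g x) x * one_plus_laplacian (\<lambda>x. f x - g x) x)
    + \<epsilon> / 2 * cell_integral P (\<lambda>x. (f x - g x) * (f x - g x))"
proof -
  let ?I = "cell_integral P"
  define v where "v = (\<lambda>x. f x - g x)"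
  have f2: "f \<in> C_per 2 P" using f by (rule C_per_mono) simp
  have vC: "v \<in> C_per 2 P" unfolding v_def using f2 g by (rule C_per_diff)
  define p where "p = one_plus_laplacian f"
  define q where "q = one_plus_laplacian g"
  define r where "r = one_plus_laplacian v"
  have pC: "p \<in> C_per 2 P" unfolding p_def using f by (intro C_per_one_plus_laplacian) (simp add: eval_nat_numeral)
  have lp: "laplacian p \<in> C_per 0 P" using C_per_laplacian[of p 0 P] pC by (simp add: numeral_2_eq_2)
  have lv: "laplacian v \<in> C_per 0 P" using C_per_laplacian[of v 0 P] vC by (simp add: numeral_2_eq_2)
  have qC: "q \<in> C_per 0 P" unfolding q_def using C_per_one_plus_laplacian[of g 0 P] g by (simp add: numeral_2_eq_2)
  have r: "r x = p x - q x" for x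
    unfolding r_def p_def q_def v_def one_plus_laplacian_def by (simp add: laplacian_diff[OF f2 g])
  have rv: "r x = v x + laplacian v x" for x by (simp add: r_def one_plus_laplacian_def)
  have rc: "continuous_on UNIV r"
    using C_per_continuous[OF pC] C_per_continuous[OF qC] by (simp add: r[abs_def] continuous_on_diff)
  note cont = C_per_continuous[OF f2] C_per_continuous[OF g] C_per_continuous[OF vC] C_per_continuous[OF pC]
    C_per_continuous[OF lp] C_per_continuous[OF lv] C_per_continuous[OF qC] rc
  have \<mu>: "chem_potential \<epsilon> f x = p x + laplacian p x + ((f x) ^ 3 - \<epsilon> * f x)" for x
    by (simp add: chem_potential_def one_plus_laplacian_def[of p] p_def[symmetric])
  have "?I (\<lambda>x. p x * r x) = ?I (\<lambda>x. p x * v x + p x * laplacian v x)"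
    by (simp add: rv algebra_simps)
  also have "\<dots> = ?I (\<lambda>x. p x * v x) + ?I (\<lambda>x. laplacian p x * v x)"
    using cont by (simp add: cell_integral_add[OF P] continuous_on_mult green_second[OF P pC vC])
  also have "\<dots> = ?I (\<lambda>x. p x * v x + laplacian p x * v x)"
    using cont by (simp add: cell_integral_add[OF P] continuous_on_mult)
  finally have pr: "?I (\<lambda>x. p x * r x) = ?I (\<lambda>x. p x * v x + laplacian p x * v x)" .
  have "energy_density \<epsilon> f x - energy_density \<epsilon> g x
      \<le> p x * r x + ((f x) ^ 3 - \<epsilon> * f x) * v x - 1/2 * (r x * r x) + \<epsilon> / 2 * (v x * v x)" for x
  proof -
    have "1/2 * (p x)\<^sup>2 - 1/2 * (q x)\<^sup>2 = p x * r x - 1/2 * (r x * r x)"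
      by (simp add: r field_simps power2_eq_square)
    with double_well_difference[of "f x" \<epsilon> "g x"] show ?thesis
      by (simp add: energy_density_def p_def[symmetric] q_def[symmetric] v_def power2_eq_square)
  qed
  then have "?I (\<lambda>x. energy_density \<epsilon> f x - energy_density \<epsilon> g x)
      \<le> ?I (\<lambda>x. p x * r x + ((f x) ^ 3 - \<epsilon> * f x) * v x - 1/2 * (r x * r x) + \<epsilon> / 2 * (v x * v x))"
    by (intro cell_integral_mono P)
      (use cont in \<open>auto simp: energy_density_def p_def[symmetric] q_def[symmetric] intro!: continuous_intros\<close>)
  also have "\<dots> = ?I (\<lambda>x. p x * r x) + ?I (\<lambda>x. ((f x) ^ 3 - \<epsilon> * f x) * v x)
      - 1/2 * ?I (\<lambda>x. r x * r x) + \<epsilon> / 2 * ?I (\<lambda>x. v x * v x)"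
    using cont
    by (simp only: cell_integral_add[OF P] cell_integral_diff[OF P] cell_integral_cmult
        continuous_on_mult continuous_on_add continuous_on_diff continuous_on_const continuous_on_power)
  also have "?I (\<lambda>x. p x * r x) + ?I (\<lambda>x. ((f x) ^ 3 - \<epsilon> * f x) * v x)
      = ?I (\<lambda>x. (p x * v x + laplacian p x * v x) + ((f x) ^ 3 - \<epsilon> * f x) * v x)"
    unfolding pr using cont
    by (intro cell_integral_add[OF P, symmetric] continuous_intros)
  also have "\<dots> = ?I (\<lambda>x. v x * chem_potential \<epsilon> f x)"
    by (simp add: \<mu> algebra_simps)
  finally have "?I (\<lambda>x. energy_density \<epsilon> f x - energy_density \<epsilon> g x)
      \<le> ?I (\<lambda>x. v x * chem_potential \<epsilon> f x) - 1/2 * ?I (\<lambda>x. r x * r x) + \<epsilon> / 2 * ?I (\<lambda>x. v x * v x)" .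
  moreover have "?I (\<lambda>x. energy_density \<epsilon> f x - energy_density \<epsilon> g x) = energy P \<epsilon> f - energy P \<epsilon> g"
    unfolding energy_eq[OF P f2] energy_eq[OF P g]
    by (intro cell_integral_diff[OF P])
      (use cont in \<open>auto simp: energy_density_def[abs_def] p_def[symmetric] q_def[symmetric] intro!: continuous_intros\<close>)
  ultimately show ?thesis unfolding r_def v_def by simp
qed

lemma L2_norm_triangle:
  assumes P: "invertible P" and f: "f \<in> C_per 0 P" and g: "g \<in> C_per 0 P"
  shows "L2_norm P (\<lambda>x. f x + g x) \<le> L2_norm P f + L2_norm P g"
proof -
  note cont = C_per_continuous[OF f] C_per_continuous[OF g]
  let ?I = "cell_integral P"
  define a where "a = ?I (\<lambda>x. f x * f x)"
  define b where "b = ?I (\<lambda>x. f x * g x)"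
  define c where "c = ?I (\<lambda>x. g x * g x)"
  have nn: "0 \<le> a" "0 \<le> c" unfolding a_def c_def by (rule cell_integral_nonneg, simp)+
  have "b\<^sup>2 \<le> a * c"
  proof (cases "c = 0")
    case True
    then have "g x = 0" for x by (intro cell_integral_square_eq_0[OF P g]) (simp only: c_def)
    then show ?thesis using True by (simp add: b_def)
  next
    case False
    have "0 \<le> ?I (\<lambda>x. (c * f x - b * g x) * (c * f x - b * g x))"
      by (rule cell_integral_nonneg) simp
    also have "(\<lambda>x. (c * f x - b * g x) * (c * f x - b * g x))
        = (\<lambda>x. c\<^sup>2 * (f x * f x) - (2 * c * b) * (f x * g x) + b\<^sup>2 * (g x * g x))"
      by (auto simp: algebra_simps power2_eq_square)
    also have "?I \<dots> = c\<^sup>2 * a - (2 * c * b) * b + b\<^sup>2 * c"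
      unfolding a_def b_def c_def using cont
      by (simp only: cell_integral_add[OF P] cell_integral_diff[OF P] cell_integral_cmult
        continuous_on_mult continuous_on_add continuous_on_diff continuous_on_const)
    also have "\<dots> = c * (a * c - b\<^sup>2)" by (simp add: algebra_simps power2_eq_square)
    finally show ?thesis using False nn by (simp add: zero_le_mult_iff)
  qed
  then have "b \<le> sqrt (a * c)" by (rule real_le_rsqrt)
  then have "b \<le> sqrt a * sqrt c" by (simp add: real_sqrt_mult)
  have "(\<lambda>x. (f x + g x) * (f x + g x)) = (\<lambda>x. f x * f x + 2 * (f x * g x) + g x * g x)"
    by (auto simp: algebra_simps)
  then have "?I (\<lambda>x. (f x + g x) * (f x + g x)) = a + 2 * b + c"
    unfolding a_def b_def c_def using cont
    by (simp only: cell_integral_add[OF P] cell_integral_cmult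
        continuous_on_mult continuous_on_add continuous_on_const)
  also have "\<dots> \<le> (sqrt a + sqrt c)\<^sup>2"
    using \<open>b \<le> sqrt a * sqrt c\<close> nn by (simp add: power2_sum)
  finally have "sqrt (?I (\<lambda>x. (f x + g x) * (f x + g x))) \<le> sqrt a + sqrt c"
    using nn by (intro real_le_lsqrt) auto
  then show ?thesis
    unfolding L2_norm_def a_def c_def using cont by (simp add: L2_inner_eq[OF P] continuous_on_add)
qed

text \<open>With \<open>g = (1 + \<Delta>) f\<close> the left side is at most \<open>\<parallel>g\<parallel> + 2\<parallel>f\<parallel>\<close>, whose square is at most
  \<open>2\<parallel>g\<parallel>\<^sup>2 + 8\<parallel>f\<parallel>\<^sup>2\<close>. Eight times the energy density plus \<open>2(2 + \<epsilon>)\<^sup>2\<close> exceeds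
  \<open>2g\<^sup>2 + 8f\<^sup>2\<close> by \<open>2g\<^sup>2 + 2(f\<^sup>2 - 2 - \<epsilon>)\<^sup>2\<close>.\<close>

lemma H2_bound:
  assumes P: "invertible P" and f: "f \<in> C_per 2 P" and E: "energy P \<epsilon> f \<le> c"
  shows "L2_norm P f + L2_norm P (laplacian f) \<le> sqrt (8 * c + 2 * (2 + \<epsilon>)\<^sup>2 * cell_area P)"
proof -
  let ?I = "cell_integral P"
  define g where "g = one_plus_laplacian f"
  have gC: "g \<in> C_per 0 P" unfolding g_def using C_per_one_plus_laplacian[of f 0 P] f by (simp add: numeral_2_eq_2)
  note cont = C_per_continuous[OF f] C_per_continuous[OF gC]
  have "laplacian f = (\<lambda>x. g x + (- 1) * f x)" by (simp add: g_def one_plus_laplacian_def)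
  then have "L2_norm P (laplacian f) \<le> L2_norm P g + L2_norm P (\<lambda>x. (- 1) * f x)"
    using L2_norm_triangle[OF P gC C_per_cmult[OF C_per_imp_0[OF f], of "-1"]] by simp
  also have "L2_norm P (\<lambda>x. (- 1) * f x) = L2_norm P f"
    by (simp add: L2_norm_def L2_inner_def)
  finally have tri: "L2_norm P f + L2_norm P (laplacian f) \<le> L2_norm P g + 2 * L2_norm P f" by simp
  have "(L2_norm P g + 2 * L2_norm P f)\<^sup>2 \<le> 2 * (L2_norm P g)\<^sup>2 + 8 * (L2_norm P f)\<^sup>2"
    using sum_squares_bound[of "L2_norm P g" "2 * L2_norm P f"] by (simp add: power2_sum power_mult_distrib)
  also have "\<dots> = ?I (\<lambda>x. 2 * (g x)\<^sup>2 + 8 * (f x)\<^sup>2)"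
    unfolding L2_norm_power2[OF P cont(1)] L2_norm_power2[OF P cont(2)] using cont
    by (simp only: cell_integral_add[OF P] cell_integral_cmult continuous_on_mult continuous_on_power continuous_on_const)
  also have "\<dots> \<le> ?I (\<lambda>x. 8 * energy_density \<epsilon> f x + 2 * (2 + \<epsilon>)\<^sup>2)"
  proof (intro cell_integral_mono P)
    fix x
    have "8 * energy_density \<epsilon> f x + 2 * (2 + \<epsilon>)\<^sup>2 - (2 * (g x)\<^sup>2 + 8 * (f x)\<^sup>2)
        = 2 * (g x)\<^sup>2 + 2 * ((f x)\<^sup>2 - (2 + \<epsilon>))\<^sup>2"
      by (simp add: energy_density_def g_def[symmetric] field_simps power2_eq_square)
    moreover have "0 \<le> 2 * (g x)\<^sup>2 + 2 * ((f x)\<^sup>2 - (2 + \<epsilon>))\<^sup>2" by simp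
    ultimately show "2 * (g x)\<^sup>2 + 8 * (f x)\<^sup>2 \<le> 8 * energy_density \<epsilon> f x + 2 * (2 + \<epsilon>)\<^sup>2" by linarith
  qed (use cont in \<open>auto simp: energy_density_def g_def[symmetric] intro!: continuous_intros\<close>)
  also have "\<dots> = 8 * ?I (energy_density \<epsilon> f) + ?I (\<lambda>x. 2 * (2 + \<epsilon>)\<^sup>2)"
  proof -
    have "continuous_on UNIV (energy_density \<epsilon> f)"
      unfolding energy_density_def[abs_def] g_def[symmetric] using cont by (intro continuous_intros) auto
    then show ?thesis
      by (simp only: cell_integral_add[OF P] cell_integral_cmult continuous_on_mult continuous_on_const)
  qed
  also have "\<dots> \<le> 8 * c + 2 * (2 + \<epsilon>)\<^sup>2 * cell_area P"
    using E by (simp add: energy_eq[OF P f])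
  finally have "L2_norm P g + 2 * L2_norm P f \<le> sqrt (8 * c + 2 * (2 + \<epsilon>)\<^sup>2 * cell_area P)"
    by (rule real_le_rsqrt)
  with tri show ?thesis by linarith
qed

lemma measure_cell:
  assumes P: "invertible P" shows "measure lebesgue (cell P) = cell_area P"
proof -
  have "cell P \<in> sets lborel" using P by simp
  moreover have "cell_area P = measure lborel (cell P)"
    unfolding cell_area_def cell_integral_def set_lebesgue_integral_def using P by simp
  ultimately show ?thesis by simp
qed

text \<open>The constant function \<open>1\<close> has maximum norm \<open>1\<close>, so the right side of the embedding inequality
  is positive there.\<close>

lemma embedding_constant_nonneg:
  assumes P: "invertible P"
    and embedding: "\<And>v. v \<in> C_per 2 P \<Longrightarrow> Linf_norm P v \<le> c * (L2_norm P v + L2_norm P (laplacian v))"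
  shows "0 \<le> c"
proof -
  have "P *v 0 \<in> cell P" unfolding cell_def by (rule imageI) simp
  then have "Linf_norm P (\<lambda>_. 1) = 1" unfolding Linf_norm_def by (subst cSUP_const) auto
  then have "1 \<le> c * (L2_norm P (\<lambda>_. 1) + L2_norm P (laplacian (\<lambda>_. 1)))"
    using embedding[OF C_per_const[of 1]] by simp
  moreover have "0 \<le> L2_norm P f" for f
  proof -
    have "0 \<le> L2_inner P f f"
      unfolding L2_inner_def set_lebesgue_integral_def by (intro integral_nonneg_AE) auto
    then show ?thesis by (simp add: L2_norm_def)
  qed
  ultimately show ?thesis by (smt (verit) mult_nonneg_nonneg mult_nonpos_nonneg)
qed

lemma chem_potential_C_per:
  assumes "f \<in> C_per 6 P" shows "chem_potential \<epsilon> f \<in> C_per 2 P"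
  unfolding chem_potential_def using assms
  by (intro C_per_diff C_per_add C_per_cmult C_per_power C_per_one_plus_laplacian)
    (auto simp: eval_nat_numeral elim: C_per_mono)

text \<open>The scheme is tested with \<open>u = (-\<Delta>)\<^sup>-\<^sup>1 v\<close> for the increment \<open>v\<close>. This turns the BDF sum into
  negative-order inner products, bounded below by the gradient structure, and the chemical
  potential into \<open>-\<langle>\<mu>, v\<rangle>\<close>, which controls the energy difference. The defect \<open>\<epsilon>/2 \<parallel>v\<parallel>\<^sup>2\<close> is
  absorbed through the interpolation inequality; the step-size condition states precisely that
  the available multiple \<open>\<sigma>/(2\<tau>)\<close> of \<open>\<parallel>v\<parallel>\<^sub>-\<^sub>1\<^sup>2\<close> is at least the required \<open>3\<epsilon>/4\<close>.\<close>

lemma mod_energy_decreasing_step: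
  fixes \<phi> :: "nat \<Rightarrow> real^2 \<Rightarrow> real"
  assumes P: "invertible P" and k: "k \<in> {3, 4, 5}" and kn: "k \<le> n" and \<epsilon>: "0 < \<epsilon>" "\<epsilon> < 1"
    and \<tau>: "0 < \<tau>" "\<tau> \<le> 2 / (3 * \<epsilon>) * sigma_L k"
    and \<phi>n: "\<phi> n \<in> C_per 6 P" and v: "\<And>i. i \<le> n \<Longrightarrow> backward_diff \<phi> i \<in> mean_zero P"
    and prev: "\<phi> (n - 1) \<in> C_per 2 P"
    and scheme: "\<And>x. bdf k \<tau> \<phi> n x = laplacian (chem_potential \<epsilon> (\<phi> n)) x"
  shows "mod_energy P \<epsilon> k \<tau> \<phi> n \<le> mod_energy P \<epsilon> k \<tau> \<phi> (n - 1)"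
proof -
  let ?I = "cell_integral P" and ?v = "backward_diff \<phi> n" and ?\<mu> = "chem_potential \<epsilon> (\<phi> n)"
  interpret Hm1: semi_inner "mean_zero P" "Hm1_inner P" by (rule semi_inner_Hm1[OF P])
  let ?sq = "\<lambda>f. (Hm1_norm P f)\<^sup>2"
  have vn: "?v \<in> mean_zero P" using v by simp
  have vc: "continuous_on UNIV (backward_diff \<phi> i)" if "i \<le> n" for i
    using v[OF that] C_per_continuous by (auto simp: mean_zero_def)
  define u where "u = inv_neg_laplacian P ?v"
  have uC: "u \<in> C_per 2 P" unfolding u_def by (rule inv_neg_laplacian_C_per[OF P vn])
  have uc: "continuous_on UNIV u" using uC by (rule C_per_continuous)
  have lu: "laplacian u x = - ?v x" for x unfolding u_def by (rule laplacian_inv_neg_laplacian[OF P vn])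
  have \<mu>C: "?\<mu> \<in> C_per 2 P" by (rule chem_potential_C_per[OF \<phi>n])
  define S where "S = (\<Sum>i<k. bdf_coeff k i * Hm1_inner P ?v (backward_diff \<phi> (n - i)))"
  have "S = ?I (\<lambda>x. \<Sum>i<k. bdf_coeff k i * (u x * backward_diff \<phi> (n - i) x))"
    unfolding S_def using vc uc
    by (subst cell_integral_sum[OF P]) (auto simp: Hm1_inner_eq[OF P vn] u_def[symmetric] intro!: continuous_intros)
  also have "(\<lambda>x. \<Sum>i<k. bdf_coeff k i * (u x * backward_diff \<phi> (n - i) x)) = (\<lambda>x. \<tau> * (u x * laplacian ?\<mu> x))"
  proof
    fix x
    have "(\<Sum>i<k. bdf_coeff k i * backward_diff \<phi> (n - i) x) = \<tau> * laplacian ?\<mu> x"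
      using scheme[of x] bdf_eq[of k n \<tau> \<phi> x] k kn \<tau> by (auto simp: field_simps)
    then show "(\<Sum>i<k. bdf_coeff k i * (u x * backward_diff \<phi> (n - i) x)) = \<tau> * (u x * laplacian ?\<mu> x)"
      by (simp add: sum_distrib_left mult.left_commute flip: sum_distrib_left)
  qed
  also have "?I \<dots> = \<tau> * ?I (\<lambda>x. laplacian u x * ?\<mu> x)"
    by (simp add: green_second[OF P uC \<mu>C])
  also have "?I (\<lambda>x. laplacian u x * ?\<mu> x) = - ?I (\<lambda>x. ?v x * ?\<mu> x)"
    by (simp add: lu)
  finally have S: "?I (\<lambda>x. ?v x * ?\<mu> x) = - (S / \<tau>)" using \<tau> by (simp add: field_simps)
  define D where "D = G k ?sq (backward_diff \<phi>) n - G k ?sq (backward_diff \<phi>) (n - 1)"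
  define b where "b = Hm1_inner P ?v ?v"
  have b: "0 \<le> b" unfolding b_def by (rule Hm1_inner_self_nonneg[OF P vn])
  have "D + sigma_L k / 2 * b \<le> S"
    unfolding D_def S_def b_def
    by (rule Hm1.bdf_gradient_structure[OF k]) (use v Hm1_norm_power2[OF P] in auto)
  then have "(D + sigma_L k / 2 * b) / \<tau> \<le> S / \<tau>" using \<tau> by (intro divide_right_mono) auto
  then have 1: "D / \<tau> + sigma_L k / (2 * \<tau>) * b \<le> S / \<tau>" using \<tau> by (simp add: field_simps)
  have "3 / 4 * \<epsilon> \<le> sigma_L k / (2 * \<tau>)" using \<tau> \<epsilon> by (simp add: field_simps)
  then have 2: "3 / 4 * \<epsilon> * b \<le> sigma_L k / (2 * \<tau>) * b" using b by (rule mult_right_mono)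
  define w where "w = ?I (\<lambda>x. one_plus_laplacian ?v x * one_plus_laplacian ?v x)"
  define z where "z = ?I (\<lambda>x. ?v x * ?v x)"
  have w: "0 \<le> w" unfolding w_def by (rule cell_integral_nonneg) simp
  have "z \<le> w + 3/2 * b" unfolding z_def w_def b_def by (rule Hm1_interpolation[OF P vn])
  then have "\<epsilon> / 2 * z \<le> \<epsilon> / 2 * (w + 3/2 * b)" using \<epsilon> by (intro mult_left_mono) auto
  also have "\<dots> \<le> 1/2 * w + 3/4 * \<epsilon> * b"
    using mult_right_mono[of \<epsilon> 1 w] \<epsilon> w by (simp add: algebra_simps)
  finally have 3: "\<epsilon> / 2 * z \<le> 1/2 * w + 3/4 * \<epsilon> * b" .
  have "energy P \<epsilon> (\<phi> n) - energy P \<epsilon> (\<phi> (n - 1)) \<le> ?I (\<lambda>x. ?v x * ?\<mu> x) - 1/2 * w + \<epsilon> / 2 * z"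
    unfolding w_def z_def backward_diff_def
    by (rule energy_difference[OF P C_per_mono[OF \<phi>n] prev]) simp
  then have "energy P \<epsilon> (\<phi> n) - energy P \<epsilon> (\<phi> (n - 1)) \<le> - (D / \<tau>)"
    using 1 2 3 S by linarith
  then show ?thesis
    unfolding mod_energy_def D_def by (simp add: diff_divide_distrib)
qed

text \<open>Integrating the scheme over the cell leaves only the newest increment, with the nonzero
  coefficient \<open>b\<^sub>0\<close>.\<close>

lemma bdf_volume_step:
  fixes \<phi> :: "nat \<Rightarrow> real^2 \<Rightarrow> real"
  assumes P: "invertible P" and k: "k \<in> {3, 4, 5}" and kn: "k \<le> n" and \<tau>: "0 < \<tau>"
    and \<phi>: "\<phi> n \<in> C_per 2 P" "\<phi> (n - 1) \<in> C_per 2 P" and v: "\<And>i. i < n \<Longrightarrow> backward_diff \<phi> i \<in> mean_zero P"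
    and \<mu>: "\<mu> \<in> C_per 2 P" and scheme: "\<And>x. bdf k \<tau> \<phi> n x = laplacian \<mu> x"
  shows "backward_diff \<phi> n \<in> mean_zero P"
proof -
  have b0: "bdf_coeff k 0 \<noteq> 0" using k bdf_coeff_values by auto
  have vC: "backward_diff \<phi> n \<in> C_per 2 P" unfolding backward_diff_def using \<phi> by (rule C_per_diff)
  have C: "backward_diff \<phi> i \<in> C_per 2 P" if "i \<le> n" for i
    using vC v[of i] that by (cases "i = n") (auto simp: mean_zero_def)
  have "(\<lambda>x. \<Sum>i<k. bdf_coeff k i * backward_diff \<phi> (n - i) x) = (\<lambda>x. \<tau> * laplacian \<mu> x)"
    using scheme bdf_eq[of k n \<tau> \<phi>] k kn \<tau> by (auto simp: field_simps)
  then have "cell_integral P (\<lambda>x. \<Sum>i<k. bdf_coeff k i * backward_diff \<phi> (n - i) x) = 0"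
    by (simp add: cell_integral_laplacian[OF P \<mu>])
  also have "cell_integral P (\<lambda>x. \<Sum>i<k. bdf_coeff k i * backward_diff \<phi> (n - i) x)
      = (\<Sum>i<k. bdf_coeff k i * cell_integral P (backward_diff \<phi> (n - i)))"
    by (subst cell_integral_sum[OF P]) (auto intro!: continuous_intros C_per_continuous[OF C])
  also have "\<dots> = (\<Sum>i\<in>{0}. bdf_coeff k i * cell_integral P (backward_diff \<phi> (n - i)))"
    using k kn v by (intro sum.mono_neutral_right) (auto simp: mean_zero_def)
  finally show ?thesis using b0 vC by (simp add: mean_zero_def)
qed

theorem lemma2p4:
  fixes P :: "real^2^2" and k N :: nat and \<epsilon> T \<tau> c\<^sub>\<Omega> c\<^sub>0 :: real
    and \<phi> :: "nat \<Rightarrow> real^2 \<Rightarrow> real"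
  assumes cell: "invertible P"
    and embedding: "\<And>v. v \<in> C_per 2 P \<Longrightarrow>
          Linf_norm P v \<le> c\<^sub>\<Omega> * (L2_norm P v + L2_norm P (laplacian v))"
    and k: "k \<in> {3, 4, 5}"
    and eps: "0 < \<epsilon>" "\<epsilon> < 1"
    and time: "0 < T" "0 < N" "\<tau> = T / real N"
    and start_regular: "\<And>l. l \<le> k - 1 \<Longrightarrow> \<phi> l \<in> C_per 2 P"
    and start_volume: "\<And>l. 1 \<le> l \<Longrightarrow> l \<le> k - 1 \<Longrightarrow>
          L2_inner P (\<phi> l) (\<lambda>_. 1) = L2_inner P (\<phi> 0) (\<lambda>_. 1)"
    and step_size: "\<tau> \<le> 2 / (3 * \<epsilon>) * min (bdf_coeff k 0) (sigma_L k)"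
    and start_energy: "mod_energy P \<epsilon> k \<tau> \<phi> (k - 1) \<le> c\<^sub>0"
    and sol_regular: "\<And>n. k \<le> n \<Longrightarrow> n \<le> N \<Longrightarrow> \<phi> n \<in> C_per 6 P"
    and scheme: "\<And>n x. k \<le> n \<Longrightarrow> n \<le> N \<Longrightarrow>
          bdf k \<tau> \<phi> n x = laplacian (chem_potential \<epsilon> (\<phi> n)) x"
  shows "\<forall>n. k \<le> n \<and> n \<le> N \<longrightarrow>
     Linf_norm P (\<phi> n)
       \<le> c\<^sub>\<Omega> * sqrt (8 * c\<^sub>0 + 2 * (2 + \<epsilon>)\<^sup>2 * measure lebesgue (cell P))"
proof (intro allI impI)
  have \<tau>: "0 < \<tau>" using time by simp
  have "2 / (3 * \<epsilon>) * min (bdf_coeff k 0) (sigma_L k) \<le> 2 / (3 * \<epsilon>) * sigma_L k"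
    using eps by (intro mult_left_mono) auto
  with step_size have \<tau>\<sigma>: "\<tau> \<le> 2 / (3 * \<epsilon>) * sigma_L k" by linarith
  have k1: "1 \<le> k" using k by auto
  \<comment> \<open>The maximum covers the starting values also when \<open>N < k - 1\<close>.\<close>
  have \<phi>2: "\<phi> n \<in> C_per 2 P" if "n \<le> max (k - 1) N" for n
  proof (cases "k \<le> n")
    case True
    then have "n \<le> N" using that k1 by auto
    then show ?thesis using C_per_mono[OF sol_regular[OF True], of 2] by simp
  next
    case False
    then show ?thesis using start_regular by simp
  qed
  have start_mean: "cell_integral P (\<phi> l) = cell_integral P (\<phi> 0)" if "l \<le> k - 1" for l
    using start_volume[of l] that start_regular[of l] start_regular[of 0] C_per_continuous
    by (cases "l = 0") (auto simp: L2_inner_eq[OF cell])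
  \<comment> \<open>At \<open>n = 0\<close> the truncated subtraction makes the backward difference the zero function.\<close>
  have v: "backward_diff \<phi> n \<in> mean_zero P" if "n \<le> max (k - 1) N" for n
    using that
  proof (induction n rule: less_induct)
    case (less n)
    show ?case
    proof (cases "k \<le> n")
      case True
      then have "n \<le> N" using less.prems k1 by auto
      show ?thesis
      proof (rule bdf_volume_step[OF cell k True \<tau>])
        show "\<phi> n \<in> C_per 2 P" "\<phi> (n - 1) \<in> C_per 2 P" using \<phi>2 less.prems by auto
        show "backward_diff \<phi> i \<in> mean_zero P" if "i < n" for i using less that by simp
        show "chem_potential \<epsilon> (\<phi> n) \<in> C_per 2 P"
          using sol_regular[OF True \<open>n \<le> N\<close>] by (rule chem_potential_C_per)
        show "bdf k \<tau> \<phi> n x = laplacian (chem_potential \<epsilon> (\<phi> n)) x" for x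
          using scheme[OF True \<open>n \<le> N\<close>] .
      qed
    next
      case False
      then have n: "n \<le> k - 1" by simp
      then have "\<phi> n \<in> C_per 2 P" "\<phi> (n - 1) \<in> C_per 2 P" using start_regular by auto
      then show ?thesis
        using start_mean[OF n] start_mean[of "n - 1"] n C_per_continuous
        by (auto simp: mean_zero_def backward_diff_def cell_integral_diff[OF cell] intro: C_per_diff)
    qed
  qed
  have decay: "mod_energy P \<epsilon> k \<tau> \<phi> n \<le> c\<^sub>0" if "k - 1 \<le> n" "n \<le> max (k - 1) N" for n
    using that
  proof (induction n rule: dec_induct)
    case base
    show ?case by (rule start_energy)
  next
    case (step n)
    have n: "k \<le> Suc n" "Suc n \<le> N" using step by auto
    have "mod_energy P \<epsilon> k \<tau> \<phi> (Suc n) \<le> mod_energy P \<epsilon> k \<tau> \<phi> (Suc n - 1)"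
      by (rule mod_energy_decreasing_step[OF cell k n(1) eps \<tau> \<tau>\<sigma> sol_regular[OF n] _ _ scheme[OF n]])
        (use v \<phi>2 n in auto)
    also have "\<dots> \<le> c\<^sub>0" using step.IH step.prems by simp
    finally show ?case .
  qed
  fix n assume n: "k \<le> n \<and> n \<le> N"
  have "0 \<le> 1 / \<tau> * G k (\<lambda>f. (Hm1_norm P f)\<^sup>2) (backward_diff \<phi>) n"
    using \<tau> by (intro mult_nonneg_nonneg G_nonneg) auto
  then have "energy P \<epsilon> (\<phi> n) \<le> c\<^sub>0"
    using decay[of n] n unfolding mod_energy_def by linarith
  then have "L2_norm P (\<phi> n) + L2_norm P (laplacian (\<phi> n)) \<le> sqrt (8 * c\<^sub>0 + 2 * (2 + \<epsilon>)\<^sup>2 * cell_area P)"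
    using \<phi>2 n by (intro H2_bound[OF cell]) auto
  then have "c\<^sub>\<Omega> * (L2_norm P (\<phi> n) + L2_norm P (laplacian (\<phi> n)))
      \<le> c\<^sub>\<Omega> * sqrt (8 * c\<^sub>0 + 2 * (2 + \<epsilon>)\<^sup>2 * cell_area P)"
    by (rule mult_left_mono[OF _ embedding_constant_nonneg[OF cell embedding]])
  then show "Linf_norm P (\<phi> n) \<le> c\<^sub>\<Omega> * sqrt (8 * c\<^sub>0 + 2 * (2 + \<epsilon>)\<^sup>2 * measure lebesgue (cell P))"
    using embedding[of "\<phi> n"] \<phi>2[of n] n unfolding measure_cell[OF cell] by force
qed

end
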